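(* Let $(Q,* )$ be a medial quandle and let $L$ be an $L_{om}$ diagram with ordered starting pair of arcs $(a_0,b_0)$ and ordered ending pair of arcs $(a_e,b_e)$ (so that $a_0,a_e$ are the two end arcs of one strand and $b_0,b_e$ the two end arcs of the other). Then every coloring $f$ of $L$ by $Q$ satisfies $f(a_0)=f(a_e)$ and $f(b_0)=f(b_e)$. The same holds for every open-strand diagram that can be transformed by Reidemeister moves (fixing the free ends) into an $L_{om}$ diagram.
   Context: A quandle is a set $Q$ with an operation $*$ such that $x*x=x$; for all $x,y$ there is a unique $q$ with $q*y=x$ (write $q=x*^{-1}y$); and $(x*y)*z=(x*z)*(y*z)$. It is medial if $(a_1*b_1)*(a_2*b_2)=(a_1*a_2)*(b_1*b_2)$ always. An open-strand diagram is an oriented planar diagram obtained from an oriented knot diagram by cutting two different arcs; the trivial one consists of two disjoint parallel segments with opposite orientations. Thus it consists of two strands with four free ends. Arcs are maximal pieces between consecutive undercrossings or free ends. At a crossing with over-arc $b$, under-arc $a$ on the left of $b$ and under-arc $c$ on the right of $b$, the crossing relation is $c=a*b$. A coloring by $Q$ assigns an element of $Q$ to every arc so that all crossing relations hold in $Q$. $L_{om}$ diagrams are the diagrams obtained from the trivial open-strand diagram by finitely many directional moves. Choose one of the two pairs of adjacent free ends of the trivial diagram as the starting pair, the other as the ending pair; each strand runs from the starting pair to the ending pair, and this gives the path direction (independent of the orientation). Moves extend the free ends, and the free pairs keep the names starting and ending pair. Parallel pairs of arcs are the two segments of the trivial diagram and, in each local structure below, the pairs $\{x,y\},\{x',y'\},\{n,m\},\{n',m'\}$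 (for types 2, 2': $\{x,y\},\{x',y'\},\{n,m\}$). Along a parallel pair the two strands run side by side with opposite orientations and the same path direction. A move takes the starting or the ending pair (the vertical pair), extends its free end without crossings through the complementary region containing it until it is next to a stretch of some parallel pair (the horizontal pair, possibly another part of the same pair), and then replaces the vertical pair and that stretch by one of the four structures below. Rotate the picture so that the vertical pair runs upward with its free end at the top, its left strand oriented down and its right strand oriented up, and the horizontal pair has lower strand oriented to the right and upper strand oriented to the left. In every structure the vertical pair makes one full twist (two crossings of its strands with each other); $x,y$ are its bottom arcs and $x',y'$ its new free top arcs. Types 1 and 1' (vertical pair passes over): $x,x'$ are left, $y,y'$ right; $n,m$ are the lower and upper horizontal arcs to the left of the vertical pair, $n',m'$ those to the right. The vertical pair makes its first crossing, passes over the lower horizontal strand (middle arc $i$), makes its second crossing, and passes over the upper horizontal strand (middle arc $j$). Type 1: $y'=y*x$, $x'=x*^{-1}y'$, $i=n*y'$, $n'=i*^{-1}x$, $j=m*^{-1}x'$, $m'=j*y'$. Type 1': $x'=x*y$, $y'=y*^{-1}x'$, $i=n*y$, $n'=i*^{-1}x'$, $j=m*^{-1}x'$, $m'=j*y'$. Types 2 and 2' (vertical pair passes under): $y,y'$ are left, $x,x'$ right; $m$ is the lower and $n$ the upper horizontal arc. The vertical pair makes its first crossing, passes under $m$, makes its second crossing, and passes under $n$. Type 2: $x_1=x*y$, $x_2=x_1*^{-1}m$, $y_1=y*^{-1}m$, $y_2=y_1*^{-1}x_2$, $x'=x_2*n$, $y'=y_2*n$. Type 2': $y_1=y*x$, $y_2=y_1*^{-1}m$,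 $x_1=x*^{-1}m$, $x_2=x_1*^{-1}y_2$, $x'=x_2*n$, $y'=y_2*n$. A move is directional if the path directions (vertical, horizontal) are (up, right) or (down, left) for types 1 and 2', and (up, left) or (down, right) for types 1' and 2. *)

theory Defs
  imports Main
begin

section \<open>Medial quandles\<close>

locale quandle =
  fixes Q :: "'a set" and mult :: "'a \<Rightarrow> 'a \<Rightarrow> 'a" (infixl "\<triangleright>" 70)
  assumes closed: "x \<in> Q \<Longrightarrow> y \<in> Q \<Longrightarrow> x \<triangleright> y \<in> Q"
    and idem: "x \<in> Q \<Longrightarrow> x \<triangleright> x = x"
    and right_div: "x \<in> Q \<Longrightarrow> y \<in> Q \<Longrightarrow> \<exists>!q. q \<in> Q \<and> q \<triangleright> y = x"
    and self_distrib: "x \<in> Q \<Longrightarrow> y \<in> Q \<Longrightarrow> z \<in> Q \<Longrightarrow> (x \<triangleright> y) \<triangleright> z = (x \<triangleright> z) \<triangleright> (y \<triangleright> z)"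

locale medial_quandle = quandle +
  assumes medial: "\<lbrakk>a1 \<in> Q; b1 \<in> Q; a2 \<in> Q; b2 \<in> Q\<rbrakk> \<Longrightarrow>
    (a1 \<triangleright> b1) \<triangleright> (a2 \<triangleright> b2) = (a1 \<triangleright> a2) \<triangleright> (b1 \<triangleright> b2)"


section \<open>Planar diagrams\<close>

text \<open>
  Oriented planar diagrams are represented up to planar isotopy as combinatorial plane graphs.
  The vertices are the crossings and, in addition, two-valent \<^emph>\<open>joints\<close>: points that merely
  subdivide a strand and carry no geometric content. An edge is an oriented piece of a strand
  between consecutive vertices or free ends (so passing over a crossing starts a new edge).
  Each edge carries the names of the complementary regions of the diagram on its left and on its
  right, and the unbounded region is distinguished. Recording the regions, rather than only the
  rotation system, is needed because a diagram may be disconnected.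

  \<open>Crossing s oi oo ui uo\<close>: the over-strand runs from edge \<open>oi\<close> to edge \<open>oo\<close>, the under-strand from
  \<open>ui\<close> to \<open>uo\<close>, and \<open>s\<close> tells whether the under-strand passes from the left to the right of the
  over-strand. \<open>Joint e e'\<close>: the strand runs from \<open>e\<close> into \<open>e'\<close>.
\<close>

datatype vertex =
    Crossing bool nat nat nat nat
  | Joint nat nat

fun passages :: "vertex \<Rightarrow> (nat \<times> nat) set" where
  "passages (Crossing s oi oo ui uo) = {(oi, oo), (ui, uo)}"
| "passages (Joint e e') = {(e, e')}"

record diagram =
  edges :: "nat set"
  verts :: "vertex set"
  lft :: "nat \<Rightarrow> nat"
  rgt :: "nat \<Rightarrow> nat"
  outer :: nat

text \<open>Two open strands: strand 1 runs from the free end at the start of the edge \<open>src1\<close> to the one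
  at the end of the edge \<open>snk1\<close>; likewise strand 2.\<close>

record two_strand_diagram = diagram +
  src1 :: nat
  snk1 :: nat
  src2 :: nat
  snk2 :: nat

definition pass :: "('z) diagram_scheme \<Rightarrow> (nat \<times> nat) set" where
  "pass D = (\<Union>v\<in>verts D. passages v)"

definition incident :: "vertex \<Rightarrow> nat set" where
  "incident v = Field (passages v)"

definition crossings :: "('z) diagram_scheme \<Rightarrow> vertex set" where
  "crossings D = {v \<in> verts D. \<exists>s oi oo ui uo. v = Crossing s oi oo ui uo}"

definition sides :: "('z) diagram_scheme \<Rightarrow> nat set \<Rightarrow> nat set" where
  "sides D K = lft D ` K \<union> rgt D ` K"

abbreviation regions :: "('z) diagram_scheme \<Rightarrow> nat set" where
  "regions D \<equiv> sides D (edges D)"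

text \<open>The two edge sides bounding the same corner of a vertex lie in the same region. With the
  over-strand drawn upwards the four equations at a crossing are for the corners north-west,
  south-west, north-east, south-east if \<open>s\<close>, and south-east, north-east, south-west, north-west
  otherwise.\<close>

fun corners_agree :: "('z) diagram_scheme \<Rightarrow> vertex \<Rightarrow> bool" where
  "corners_agree D (Crossing s oi oo ui uo) \<longleftrightarrow>
     (if s
      then lft D ui = lft D oo \<and> rgt D ui = lft D oi \<and> lft D uo = rgt D oo \<and> rgt D uo = rgt D oi
      else lft D ui = rgt D oi \<and> rgt D ui = rgt D oo \<and> lft D uo = lft D oi \<and> rgt D uo = lft D oo)"
| "corners_agree D (Joint e e') \<longleftrightarrow> lft D e = lft D e' \<and> rgt D e = rgt D e'"

text \<open>Every edge enters at most one vertex and leaves at most one vertex, each in one place.\<close>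

definition well_formed :: "('z) diagram_scheme \<Rightarrow> bool" where
  "well_formed D \<longleftrightarrow>
     finite (edges D) \<and> finite (verts D) \<and> outer D \<in> regions D \<and>
     (\<forall>v\<in>verts D. corners_agree D v) \<and>
     (\<forall>s oi oo ui uo. Crossing s oi oo ui uo \<in> verts D \<longrightarrow> oi \<noteq> ui \<and> oo \<noteq> uo) \<and>
     (\<forall>v\<in>verts D. \<forall>w\<in>verts D. v \<noteq> w \<longrightarrow>
        Domain (passages v) \<inter> Domain (passages w) = {} \<and>
        Range (passages v) \<inter> Range (passages w) = {})"

text \<open>A knot diagram is a single closed strand. The last conjunct is Euler's formula
  \<open>V - E + F = 2\<close>: with \<open>n\<close> crossings and \<open>k\<close> joints, \<open>V = n + k\<close> and \<open>E = 2 * n + k\<close>. Since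
  corners agree, the named regions are at most as many as the faces of the rotation system, so
  the formula says both that the genus is 0 and that different faces have different names.\<close>

definition knot_diagram :: "diagram \<Rightarrow> bool" where
  "knot_diagram K \<longleftrightarrow>
     well_formed K \<and> edges K \<noteq> {} \<and>
     Domain (pass K) = edges K \<and> Range (pass K) = edges K \<and>
     (\<forall>e\<in>edges K. \<forall>e'\<in>edges K. (e, e') \<in> (pass K)\<^sup>*) \<and>
     card (regions K) = card (crossings K) + 2"

definition adjacent :: "('z) diagram_scheme \<Rightarrow> (nat \<times> nat) set" where
  "adjacent D = {(e, e'). \<exists>v\<in>verts D. e \<in> incident v \<and> e' \<in> incident v}"

definition components :: "('z) diagram_scheme \<Rightarrow> nat set set" where
  "components D = edges D // (adjacent D)\<^sup>*"

definition cofacial :: "('z) diagram_scheme \<Rightarrow> (nat \<times> nat) set" where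
  "cofacial D = {(e, e'). e \<in> edges D \<and> e' \<in> edges D \<and> sides D {e} \<inter> sides D {e'} \<noteq> {}}"

text \<open>Planar diagrams of two open strands. Around a free end the left and the right side of its edge
  are in the same region. With \<open>n\<close> crossings, \<open>k\<close> joints and 4 free ends, \<open>V = n + k + 4\<close> and
  \<open>E = 2 * n + k + 2\<close>, so Euler's formula for plane graphs \<open>V - E + R = 1 + C\<close> (with \<open>C\<close> components and
  \<open>R\<close> regions) becomes \<open>R + 1 = n + C\<close>. For \<open>C = 2\<close> the components must moreover share a
  region; together these say that the faces are glued as in the plane.\<close>

definition planar :: "two_strand_diagram \<Rightarrow> bool" where
  "planar D \<longleftrightarrow>
     well_formed D \<and>
     {src1 D, snk1 D, src2 D, snk2 D} \<subseteq> edges D \<and> src1 D \<noteq> src2 D \<and> snk1 D \<noteq> snk2 D \<and>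
     Domain (pass D) = edges D - {snk1 D, snk2 D} \<and>
     Range (pass D) = edges D - {src1 D, src2 D} \<and>
     (src1 D, snk1 D) \<in> (pass D)\<^sup>* \<and> (src2 D, snk2 D) \<in> (pass D)\<^sup>* \<and>
     edges D \<subseteq> (pass D)\<^sup>* `` {src1 D, src2 D} \<and>
     (\<forall>e\<in>{src1 D, snk1 D, src2 D, snk2 D}. lft D e = rgt D e) \<and>
     (src1 D, src2 D) \<in> (adjacent D \<union> cofacial D)\<^sup>* \<and>
     card (regions D) + 1 = card (crossings D) + card (components D)"

text \<open>Open-strand diagrams: a knot diagram is cut at two different points, represented as joints
  \<open>Joint e1 f1\<close> and \<open>Joint e2 f2\<close>; a cut merges the regions on the two sides of the strand.\<close>

definition cut_knot ::
  "diagram \<Rightarrow> nat \<Rightarrow> nat \<Rightarrow> nat \<Rightarrow> nat \<Rightarrow> two_strand_diagram \<Rightarrow> bool" where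
  "cut_knot K e1 f1 e2 f2 D \<longleftrightarrow>
     Joint e1 f1 \<in> verts K \<and> Joint e2 f2 \<in> verts K \<and> Joint e1 f1 \<noteq> Joint e2 f2 \<and>
     edges D = edges K \<and> verts D = verts K - {Joint e1 f1, Joint e2 f2} \<and>
     src1 D = f2 \<and> snk1 D = e1 \<and> src2 D = f1 \<and> snk2 D = e2 \<and>
     (\<exists>\<mu>. (\<forall>e\<in>edges K. lft D e = \<mu> (lft K e) \<and> rgt D e = \<mu> (rgt K e)) \<and>
          outer D = \<mu> (outer K) \<and>
          (\<forall>a\<in>regions K. \<forall>b\<in>regions K. \<mu> a = \<mu> b \<longleftrightarrow>
             equivclp (\<lambda>a b. (a, b) \<in> {(lft K e1, rgt K e1), (lft K e2, rgt K e2)}) a b))"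

definition open_strand_diagram :: "two_strand_diagram \<Rightarrow> bool" where
  "open_strand_diagram D \<longleftrightarrow> (\<exists>K e1 f1 e2 f2. knot_diagram K \<and> cut_knot K e1 f1 e2 f2 D)"


section \<open>Arcs and colorings\<close>

text \<open>Arcs end only at undercrossings and free ends, so they continue over crossings and joints.\<close>

fun over_passages :: "vertex \<Rightarrow> (nat \<times> nat) set" where
  "over_passages (Crossing s oi oo ui uo) = {(oi, oo)}"
| "over_passages (Joint e e') = {(e, e')}"

definition arc :: "('z) diagram_scheme \<Rightarrow> nat \<Rightarrow> nat set" where
  "arc D e = {e'. equivclp (\<lambda>a b. \<exists>v\<in>verts D. (a, b) \<in> over_passages v) e e'}"

definition arcs :: "('z) diagram_scheme \<Rightarrow> nat set set" where
  "arcs D = arc D ` edges D"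

definition under_left :: "bool \<Rightarrow> nat \<Rightarrow> nat \<Rightarrow> nat" where
  "under_left s ui uo = (if s then ui else uo)"

definition under_right :: "bool \<Rightarrow> nat \<Rightarrow> nat \<Rightarrow> nat" where
  "under_right s ui uo = (if s then uo else ui)"

definition coloring ::
  "'a set \<Rightarrow> ('a \<Rightarrow> 'a \<Rightarrow> 'a) \<Rightarrow> ('z) diagram_scheme \<Rightarrow> (nat set \<Rightarrow> 'a) \<Rightarrow> bool" where
  "coloring Q mult D f \<longleftrightarrow>
     (\<forall>\<alpha>\<in>arcs D. f \<alpha> \<in> Q) \<and>
     (\<forall>s oi oo ui uo. Crossing s oi oo ui uo \<in> verts D \<longrightarrow>
        f (arc D (under_right s ui uo)) = mult (f (arc D (under_left s ui uo))) (f (arc D oi)))"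

text \<open>Strand 1 is the strand whose orientation agrees with the path direction, so the starting pair
  consists of the start of strand 1 and the end of strand 2. The components are ordered so that
  the first components of both pairs belong to strand 1, the second ones to strand 2.\<close>

definition starting_pair :: "two_strand_diagram \<Rightarrow> nat set \<times> nat set" where
  "starting_pair D = (arc D (src1 D), arc D (snk2 D))"

definition ending_pair :: "two_strand_diagram \<Rightarrow> nat set \<times> nat set" where
  "ending_pair D = (arc D (snk1 D), arc D (src2 D))"


section \<open>Planar isotopy and Reidemeister moves\<close>

fun map_vertex :: "(nat \<Rightarrow> nat) \<Rightarrow> vertex \<Rightarrow> vertex" where
  "map_vertex g (Crossing s oi oo ui uo) = Crossing s (g oi) (g oo) (g ui) (g uo)"
| "map_vertex g (Joint e e') = Joint (g e) (g e')"

definition renaming :: "two_strand_diagram \<Rightarrow> two_strand_diagram \<Rightarrow> bool" where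
  "renaming D D' \<longleftrightarrow> (\<exists>g h. inj_on g (edges D) \<and> inj_on h (regions D) \<and>
     edges D' = g ` edges D \<and> verts D' = map_vertex g ` verts D \<and>
     (\<forall>e\<in>edges D. lft D' (g e) = h (lft D e) \<and> rgt D' (g e) = h (rgt D e)) \<and>
     outer D' = h (outer D) \<and>
     src1 D' = g (src1 D) \<and> snk1 D' = g (snk1 D) \<and>
     src2 D' = g (src2 D) \<and> snk2 D' = g (snk2 D))"

text \<open>Subdividing \<open>e\<close> by a joint: \<open>e\<close> remains the first part, the new edge \<open>e'\<close> is the second.\<close>

fun replace_in :: "nat \<Rightarrow> nat \<Rightarrow> vertex \<Rightarrow> vertex" where
  "replace_in e e' (Crossing s oi oo ui uo) =
     Crossing s (if oi = e then e' else oi) oo (if ui = e then e' else ui) uo"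
| "replace_in e e' (Joint a b) = Joint (if a = e then e' else a) b"

definition subdivide :: "nat \<Rightarrow> nat \<Rightarrow> two_strand_diagram \<Rightarrow> two_strand_diagram" where
  "subdivide e e' D = D\<lparr>
     edges := insert e' (edges D),
     verts := insert (Joint e e') (replace_in e e' ` verts D),
     lft := (lft D)(e' := lft D e),
     rgt := (rgt D)(e' := rgt D e),
     snk1 := (if snk1 D = e then e' else snk1 D),
     snk2 := (if snk2 D = e then e' else snk2 D)\<rparr>"

definition subdivision :: "two_strand_diagram \<Rightarrow> two_strand_diagram \<Rightarrow> bool" where
  "subdivision D D' \<longleftrightarrow> (\<exists>e e'. e \<in> edges D \<and> e' \<notin> edges D \<and> D' = subdivide e e' D)"

text \<open>All local moves below replace vertices \<open>V\<close> of \<open>D\<close> by vertices \<open>V'\<close>, keeping edges and free ends;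
  where fewer crossings are needed the strands just run through joints. \<open>I\<close> contains the edges inside
  the changed local picture. Each region of \<open>D'\<close> met by another edge lies in the corresponding
  region of \<open>D\<close>, as expressed by \<open>\<pi>\<close>; for planar \<open>D\<close> and \<open>D'\<close> this determines which regions are
  split, and in particular forces strands of \<open>D\<close> that are brought together to be next to a common
  region. The regions of \<open>D'\<close> met only by edges of \<open>I\<close> are the small ones created by the
  move; they do not contain the point at infinity.\<close>

definition local_change ::
  "nat set \<Rightarrow> vertex set \<Rightarrow> vertex set \<Rightarrow> two_strand_diagram \<Rightarrow> two_strand_diagram \<Rightarrow> bool" where
  "local_change I V V' D D' \<longleftrightarrow>
     edges D' = edges D \<and>
     src1 D' = src1 D \<and> snk1 D' = snk1 D \<and> src2 D' = src2 D \<and> snk2 D' = snk2 D \<and>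
     V \<subseteq> verts D \<and> V' \<inter> (verts D - V) = {} \<and> verts D' = (verts D - V) \<union> V' \<and>
     (\<exists>\<pi>. (\<forall>e\<in>edges D - I. lft D e = \<pi> (lft D' e) \<and> rgt D e = \<pi> (rgt D' e)) \<and>
          outer D = \<pi> (outer D')) \<and>
     outer D' \<in> sides D' (edges D - I)"

text \<open>The edges \<open>I\<close> bound a common region that no other edge meets.\<close>

definition bound_face :: "two_strand_diagram \<Rightarrow> nat set \<Rightarrow> bool" where
  "bound_face D I \<longleftrightarrow> (\<exists>b. (\<forall>e\<in>I. b \<in> sides D {e}) \<and> b \<notin> sides D (edges D - I))"

definition cross :: "bool \<Rightarrow> nat \<times> nat \<Rightarrow> nat \<times> nat \<Rightarrow> vertex" where
  "cross s p q = Crossing s (fst p) (snd p) (fst q) (snd q)"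

text \<open>\<open>D'\<close> has an additional monogon, with boundary \<open>e2\<close>.\<close>

definition reidemeister1 :: "two_strand_diagram \<Rightarrow> two_strand_diagram \<Rightarrow> bool" where
  "reidemeister1 D D' \<longleftrightarrow> (\<exists>e1 e2 e3 s c. distinct [e1, e2, e3] \<and>
     c \<in> {cross s (e1, e2) (e2, e3), cross s (e2, e3) (e1, e2)} \<and>
     local_change {e2} {Joint e1 e2, Joint e2 e3} {c} D D' \<and> bound_face D' {e2})"

text \<open>\<open>D'\<close> has an additional bigon with boundary \<open>e2\<close> (over) and \<open>f2\<close> (under); the strands may
  run in the same or in opposite directions.\<close>

definition reidemeister2 :: "two_strand_diagram \<Rightarrow> two_strand_diagram \<Rightarrow> bool" where
  "reidemeister2 D D' \<longleftrightarrow> (\<exists>e1 e2 e3 f1 f2 f3 s C. distinct [e1, e2, e3, f1, f2, f3] \<and>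
     C \<in> {{cross s (e1, e2) (f1, f2), cross (\<not> s) (e2, e3) (f2, f3)},
          {cross s (e1, e2) (f2, f3), cross (\<not> s) (e2, e3) (f1, f2)}} \<and>
     local_change {e2, f2} {Joint e1 e2, Joint e2 e3, Joint f1 f2, Joint f2 f3} C D D' \<and>
     bound_face D' {e2, f2})"

text \<open>Three crossings of a top strand \<open>t\<close>, a middle strand \<open>m\<close> and a bottom strand \<open>b\<close>, each of
  which is given by three consecutive edges. The Booleans \<open>p\<close>, \<open>q\<close>, \<open>r\<close> tell whether \<open>t\<close> meets \<open>m\<close> before
  \<open>b\<close>, \<open>m\<close> meets \<open>t\<close> before \<open>b\<close>, and \<open>b\<close> meets \<open>t\<close> before \<open>m\<close>. The third move reverses all three
  orders and keeps the directions of the crossings.\<close>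

definition at :: "bool \<Rightarrow> (nat \<Rightarrow> nat) \<Rightarrow> nat \<times> nat" where
  "at first e = (if first then (e 0, e 1) else (e 1, e 2))"

definition triple ::
  "(nat \<Rightarrow> nat) \<Rightarrow> (nat \<Rightarrow> nat) \<Rightarrow> (nat \<Rightarrow> nat) \<Rightarrow> bool \<Rightarrow> bool \<Rightarrow> bool \<Rightarrow>
   bool \<Rightarrow> bool \<Rightarrow> bool \<Rightarrow> vertex set" where
  "triple t m b s1 s2 s3 p q r =
     {cross s1 (at p t) (at q m), cross s2 (at (\<not> p) t) (at r b), cross s3 (at (\<not> q) m) (at (\<not> r) b)}"

definition reidemeister3 :: "two_strand_diagram \<Rightarrow> two_strand_diagram \<Rightarrow> bool" where
  "reidemeister3 D D' \<longleftrightarrow> (\<exists>t m b s1 s2 s3 p q r.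
     distinct (map t [0..<3] @ map m [0..<3] @ map b [0..<3]) \<and>
     local_change {t 1, m 1, b 1}
       (triple t m b s1 s2 s3 p q r) (triple t m b s1 s2 s3 (\<not> p) (\<not> q) (\<not> r)) D D' \<and>
     bound_face D {t 1, m 1, b 1} \<and> bound_face D' {t 1, m 1, b 1})"

definition isotopic :: "two_strand_diagram \<Rightarrow> two_strand_diagram \<Rightarrow> bool" where
  "isotopic = equivclp (\<lambda>D D'. planar D \<and> planar D' \<and> (renaming D D' \<or> subdivision D D'))"

definition reidemeister_equivalent :: "two_strand_diagram \<Rightarrow> two_strand_diagram \<Rightarrow> bool" where
  "reidemeister_equivalent = equivclp (\<lambda>D D'. planar D \<and> planar D' \<and>
     (renaming D D' \<or> subdivision D D' \<or>
      reidemeister1 D D' \<or> reidemeister2 D D' \<or> reidemeister3 D D'))"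


section \<open>The diagrams \<open>L_om\<close>\<close>

text \<open>
  Notation for the four structures. The vertical pair consists of the strand \<open>l\<close> that is on the left
  at the bottom and at the top (oriented downwards) and the strand \<open>r\<close> (oriented upwards), both
  cut into pieces \<open>0, ..., 4\<close> numbered from bottom to top. The lower horizontal strand \<open>h\<close>
  (oriented to the right) and the upper one \<open>k\<close> (oriented to the left) are cut into pieces \<open>0, 1, 2\<close>
  numbered from left to right. Between its two crossings with itself the vertical pair is interchanged,
  so there \<open>r\<close> is on the left. The comments give the crossing relations; the letters of the
  arcs are

  \<^item> type 1: \<open>x = l 0, l 1, l 2\<close>, \<open>x' = l 3, l 4\<close>, \<open>y = r 0\<close>, \<open>y' = r 1, ..., r 4\<close>;
  \<^item> type 1': \<open>x = l 0\<close>, \<open>x' = l 1, ..., l 4\<close>, \<open>y = r 0, r 1, r 2\<close>, \<open>y' = r 3, r 4\<close>;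
  \<^item> types 1 and 1': \<open>n, i, n' = h 0, h 1, h 2\<close> and \<open>m, j, m' = k 0, k 1, k 2\<close>;
  \<^item> type 2: \<open>y = l 0, l 1\<close>, \<open>y1 = l 2\<close>, \<open>y2 = l 3\<close>, \<open>y' = l 4\<close>, \<open>x = r 0\<close>, \<open>x1 = r 1\<close>,
    \<open>x2 = r 2, r 3\<close>, \<open>x' = r 4\<close>;
  \<^item> type 2': \<open>y = l 0\<close>, \<open>y1 = l 1\<close>, \<open>y2 = l 2, l 3\<close>, \<open>y' = l 4\<close>, \<open>x = r 0, r 1\<close>, \<open>x1 = r 2\<close>,
    \<open>x2 = r 3\<close>, \<open>x' = r 4\<close>;
  \<^item> types 2 and 2': \<open>m = h 0, h 1, h 2\<close> and \<open>n = k 0, k 1, k 2\<close>.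
\<close>

datatype move_type = Type1 | Type1' | Type2 | Type2'

fun structure_crossings ::
  "move_type \<Rightarrow> (nat \<Rightarrow> nat) \<Rightarrow> (nat \<Rightarrow> nat) \<Rightarrow> (nat \<Rightarrow> nat) \<Rightarrow> (nat \<Rightarrow> nat) \<Rightarrow> vertex set" where
  "structure_crossings Type1 l r h k =
    {Crossing True  (l 1) (l 0) (r 0) (r 1),   \<comment> \<open>\<open>y' = y * x\<close>\<close>
     Crossing True  (r 1) (r 2) (h 0) (h 1),   \<comment> \<open>\<open>i = n * y'\<close>\<close>
     Crossing False (l 2) (l 1) (h 1) (h 2),   \<comment> \<open>\<open>i = n' * x\<close>\<close>
     Crossing True  (r 2) (r 3) (l 3) (l 2),   \<comment> \<open>\<open>x = x' * y'\<close>\<close>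
     Crossing True  (l 4) (l 3) (k 1) (k 0),   \<comment> \<open>\<open>m = j * x'\<close>\<close>
     Crossing False (r 3) (r 4) (k 2) (k 1)}   \<comment> \<open>\<open>m' = j * y'\<close>\<close>"
| "structure_crossings Type1' l r h k =
    {Crossing False (r 0) (r 1) (l 1) (l 0),   \<comment> \<open>\<open>x' = x * y\<close>\<close>
     Crossing True  (r 1) (r 2) (h 0) (h 1),   \<comment> \<open>\<open>i = n * y\<close>\<close>
     Crossing False (l 2) (l 1) (h 1) (h 2),   \<comment> \<open>\<open>i = n' * x'\<close>\<close>
     Crossing False (l 3) (l 2) (r 2) (r 3),   \<comment> \<open>\<open>y = y' * x'\<close>\<close>
     Crossing True  (l 4) (l 3) (k 1) (k 0),   \<comment> \<open>\<open>m = j * x'\<close>\<close>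
     Crossing False (r 3) (r 4) (k 2) (k 1)}   \<comment> \<open>\<open>m' = j * y'\<close>\<close>"
| "structure_crossings Type2 l r h k =
    {Crossing True  (l 1) (l 0) (r 0) (r 1),   \<comment> \<open>\<open>x1 = x * y\<close>\<close>
     Crossing False (h 0) (h 1) (r 1) (r 2),   \<comment> \<open>\<open>x1 = x2 * m\<close>\<close>
     Crossing True  (h 1) (h 2) (l 2) (l 1),   \<comment> \<open>\<open>y = y1 * m\<close>\<close>
     Crossing True  (r 2) (r 3) (l 3) (l 2),   \<comment> \<open>\<open>y1 = y2 * x2\<close>\<close>
     Crossing False (k 1) (k 0) (l 4) (l 3),   \<comment> \<open>\<open>y' = y2 * n\<close>\<close>
     Crossing True  (k 2) (k 1) (r 3) (r 4)}   \<comment> \<open>\<open>x' = x2 * n\<close>\<close>"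
| "structure_crossings Type2' l r h k =
    {Crossing False (r 0) (r 1) (l 1) (l 0),   \<comment> \<open>\<open>y1 = y * x\<close>\<close>
     Crossing False (h 0) (h 1) (r 1) (r 2),   \<comment> \<open>\<open>x = x1 * m\<close>\<close>
     Crossing True  (h 1) (h 2) (l 2) (l 1),   \<comment> \<open>\<open>y1 = y2 * m\<close>\<close>
     Crossing False (l 3) (l 2) (r 2) (r 3),   \<comment> \<open>\<open>x1 = x2 * y2\<close>\<close>
     Crossing False (k 1) (k 0) (l 4) (l 3),   \<comment> \<open>\<open>y' = y2 * n\<close>\<close>
     Crossing True  (k 2) (k 1) (r 3) (r 4)}   \<comment> \<open>\<open>x' = x2 * n\<close>\<close>"

definition structure_joints ::
  "(nat \<Rightarrow> nat) \<Rightarrow> (nat \<Rightarrow> nat) \<Rightarrow> (nat \<Rightarrow> nat) \<Rightarrow> (nat \<Rightarrow> nat) \<Rightarrow> vertex set" where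
  "structure_joints l r h k =
     {Joint (l (Suc i)) (l i) | i. i < 4} \<union> {Joint (r i) (r (Suc i)) | i. i < 4} \<union>
     {Joint (h i) (h (Suc i)) | i. i < 2} \<union> {Joint (k (Suc i)) (k i) | i. i < 2}"

text \<open>Path directions: \<open>up\<close> and \<open>right\<close> are true if the path runs up along the vertical pair
  resp. to the right along the horizontal pair. As strand 1 follows the path, the vertical pair
  is the ending pair if \<open>up\<close> and the starting pair otherwise.\<close>

fun directional :: "move_type \<Rightarrow> bool \<Rightarrow> bool \<Rightarrow> bool" where
  "directional Type1 up right \<longleftrightarrow> up = right"
| "directional Type2' up right \<longleftrightarrow> up = right"
| "directional Type1' up right \<longleftrightarrow> up \<noteq> right"
| "directional Type2 up right \<longleftrightarrow> up \<noteq> right"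

definition free_pair :: "bool \<Rightarrow> two_strand_diagram \<Rightarrow> nat \<times> nat" where
  "free_pair up D = (if up then (src2 D, snk1 D) else (src1 D, snk2 D))"

text \<open>A parallel pair of edges is written \<open>(e, e')\<close> with \<open>e\<close> on strand 1 and \<open>e'\<close> on strand 2.\<close>

definition along :: "bool \<Rightarrow> nat \<Rightarrow> nat \<Rightarrow> nat \<times> nat" where
  "along d e e' = (if d then (e, e') else (e', e))"

text \<open>Heights at which the two vertical strands are not side by side in one of the parallel pairs of
  the structure: inside the twist and, for types 2 and 2', at \<open>x2, y2\<close>.\<close>

fun twisted :: "move_type \<Rightarrow> nat set" where
  "twisted Type1 = {1, 2}"
| "twisted Type1' = {1, 2}"
| "twisted Type2 = {1, 2, 3}"
| "twisted Type2' = {1, 2, 3}"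

text \<open>\<open>lom_construction D P\<close>: the diagram \<open>D\<close> results from the trivial one by directional moves, and \<open>P\<close> is
  the set of pairs of edges in which the strands run along a parallel pair.

  In the move, \<open>D\<close> already has the free pair \<open>l, r\<close> extended and the two pairs
  cut into pieces by joints (rule \<open>subdivide_pair\<close>). The free ends and the right side of the lower
  strand \<open>h\<close> are in a common region, and \<open>local_change\<close> with planarity of \<open>D'\<close> says that the structure
  is inserted there without further crossings; the last condition on \<open>outer\<close> says that
  the point at infinity is not enclosed between the extended strands.\<close>

inductive lom_construction :: "two_strand_diagram \<Rightarrow> (nat \<times> nat) set \<Rightarrow> bool" where
  trivial: "\<lbrakk>a \<noteq> b; edges D = {a, b}; verts D = {};
      lft D a = outer D; rgt D a = outer D; lft D b = outer D; rgt D b = outer D;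
      src1 D = a; snk1 D = a; src2 D = b; snk2 D = b\<rbrakk>
    \<Longrightarrow> lom_construction D {(a, b)}"
| subdivide_pair: "\<lbrakk>lom_construction D P; (e, f) \<in> P; e' \<notin> edges D; f' \<notin> edges D; e' \<noteq> f'\<rbrakk>
    \<Longrightarrow> lom_construction (subdivide e e' (subdivide f f' D)) (P - {(e, f)} \<union> {(e, f'), (e', f)})"
| move: "\<lbrakk>lom_construction D P; directional ty up right;
      distinct (map l [0..<5] @ map r [0..<5] @ map h [0..<3] @ map k [0..<3]);
      (l 4, r 4) = free_pair up D;
      \<And>i. i < 5 \<Longrightarrow> along up (r i) (l i) \<in> P;
      \<And>i. i < 3 \<Longrightarrow> along right (h i) (k i) \<in> P;
      rgt D (l 4) = rgt D (h 0);
      local_change ({l i | i. 0 < i \<and> i < 5} \<union> {r i | i. 0 < i \<and> i < 5} \<union> {h 1, k 1})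
        (structure_joints l r h k) (structure_crossings ty l r h k) D D';
      planar D'; outer D' \<noteq> lft D' (l 0);
      P' = P - ({along up (r i) (l i) | i. i \<in> twisted ty} \<union> {along right (h 1) (k 1)})\<rbrakk>
    \<Longrightarrow> lom_construction D' P'"

definition lom_diagram :: "two_strand_diagram \<Rightarrow> bool" where
  "lom_diagram L \<longleftrightarrow> (\<exists>D P. lom_construction D P \<and> isotopic D L)"

end

(*
  In a medial quandle the displacements R_x R_y^-1 (with R_y the right translation by y) commute.
  A parallel pair of strands with colors x, y acts on everything that passes under it by its
  displacement, and a displacement applied to both colors of a pair does not change the displacement
  of that pair. In types 1 and 1' the vertical pair is shifted by its own displacement and the
  horizontal pair by the inverse one, measured in path direction; in types 2 and 2' the vertical
  pair is shifted by the quotient of the displacements of the two pairs, which is trivial because all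
  pairs of a diagram have the same displacement. To make this an induction over the construction, the
  claim is generalized to colorings that may change by a displacement along each parallel pair: the
  end pair is then the start pair shifted by the product of these displacements. Reidemeister moves
  preserve the statement because they transfer colorings without changing the colors of the free ends.
*)
theory Submission
  imports Defs "HOL-Library.Multiset"
begin

section \<open>Displacements of a medial quandle\<close>

text \<open>A move changes colors not only at the free pair but also along a stretch in the middle
  of the old diagram, so a coloring of the new diagram is in general not one of the old. This is why
  an edge gets separate colors at its start and at its end, and why the jump along a parallel pair
  is given by an arbitrary function \<open>d\<close>: since the induction hypothesis holds for every
  \<open>d\<close>, it applies to the old diagram with the effect of the six crossings entered as
  two additional jumps. Directionality is what makes the total of these two jumps trivial. The order
  in which the path meets the jumps is never tracked. As displacements commute, only their total
  matters, so a jump is a multiset of pairs of colors and the total is a plain sum over the set of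
  parallel pairs.\<close>

context quandle
begin

definition rdiv :: "'a \<Rightarrow> 'a \<Rightarrow> 'a" (infixl "\<triangleleft>" 70) where
  "x \<triangleleft> y = (THE q. q \<in> Q \<and> q \<triangleright> y = x)"

lemma rdiv_props:
  assumes "x \<in> Q" "y \<in> Q"
  shows rdiv_closed: "x \<triangleleft> y \<in> Q" and rdiv_mult: "(x \<triangleleft> y) \<triangleright> y = x"
  using theI'[OF right_div[OF assms]] by (simp_all add: rdiv_def)

lemma mult_cancel:
  assumes "x \<in> Q" "y \<in> Q" "z \<in> Q" "x \<triangleright> z = y \<triangleright> z"
  shows "x = y"
  using right_div[OF closed[OF assms(1,3)] assms(3)] assms by metis

lemma mult_rdiv: "x \<in> Q \<Longrightarrow> y \<in> Q \<Longrightarrow> (x \<triangleright> y) \<triangleleft> y = x"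
  by (meson closed mult_cancel rdiv_closed rdiv_mult)

lemma rdiv_eqI: "x \<in> Q \<Longrightarrow> y \<in> Q \<Longrightarrow> x \<triangleright> y = z \<Longrightarrow> z \<triangleleft> y = x"
  using mult_rdiv by blast

lemma mult_eqD: "w = z \<triangleright> y \<Longrightarrow> z \<in> Q \<Longrightarrow> y \<in> Q \<Longrightarrow> z = w \<triangleleft> y"
  using mult_rdiv by simp

lemma rdiv_idem: "x \<in> Q \<Longrightarrow> x \<triangleleft> x = x"
  using idem mult_rdiv by metis

lemma mult_distrib_rdiv:
  assumes "x \<in> Q" "y \<in> Q" "z \<in> Q"
  shows "(x \<triangleright> y) \<triangleleft> z = (x \<triangleleft> z) \<triangleright> (y \<triangleleft> z)"
  using self_distrib[of "x \<triangleleft> z" "y \<triangleleft> z" z]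
  by (intro rdiv_eqI closed) (simp_all add: assms rdiv_closed rdiv_mult)

lemma rdiv_mult_distrib:
  assumes "x \<in> Q" "y \<in> Q" "z \<in> Q"
  shows "(x \<triangleleft> y) \<triangleright> z = (x \<triangleright> z) \<triangleleft> (y \<triangleright> z)"
  using self_distrib[of "x \<triangleleft> y" y z] assms
  by (intro mult_eqD closed rdiv_closed) (simp_all add: rdiv_mult rdiv_closed)

lemma rdiv_rdiv_distrib:
  assumes "x \<in> Q" "y \<in> Q" "z \<in> Q"
  shows "(x \<triangleleft> y) \<triangleleft> z = (x \<triangleleft> z) \<triangleleft> (y \<triangleleft> z)"
  using mult_distrib_rdiv[of "x \<triangleleft> y" y z] assms
  by (intro mult_eqD rdiv_closed) (simp_all add: rdiv_mult rdiv_closed)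

text \<open>Extended by the identity, so that displacements commute on the whole type, as \<^const>\<open>fold_mset\<close> requires.\<close>

definition disp :: "'a \<times> 'a \<Rightarrow> 'a \<Rightarrow> 'a" where
  "disp p z = (if fst p \<in> Q \<and> snd p \<in> Q \<and> z \<in> Q then (z \<triangleleft> snd p) \<triangleright> fst p else z)"

lemma disp_eq: "x \<in> Q \<Longrightarrow> y \<in> Q \<Longrightarrow> z \<in> Q \<Longrightarrow> disp (x, y) z = (z \<triangleleft> y) \<triangleright> x"
  by (simp add: disp_def)

lemma disp_closed: "z \<in> Q \<Longrightarrow> disp p z \<in> Q"
  by (simp add: disp_def closed rdiv_closed)

lemma disp_swap: "disp (prod.swap p) (disp p z) = z"
  by (simp add: disp_def closed rdiv_closed rdiv_mult mult_rdiv)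

lemma disp_mult:
  "x \<in> Q \<Longrightarrow> y \<in> Q \<Longrightarrow> disp p (x \<triangleright> y) = disp p x \<triangleright> disp p y"
  by (auto simp: disp_def closed rdiv_closed mult_distrib_rdiv intro: self_distrib)

lemma disp_rdiv:
  "x \<in> Q \<Longrightarrow> y \<in> Q \<Longrightarrow> disp p (x \<triangleleft> y) = disp p x \<triangleleft> disp p y"
  using disp_mult[of "x \<triangleleft> y" y p]
  by (intro rdiv_eqI[symmetric] disp_closed) (simp_all add: rdiv_closed rdiv_mult)

text \<open>Serves a strand that passes under the vertical pair inside its twist, where one of the
  two strands already has the color \<open>y \<triangleright> x\<close>: the effect is still a
  displacement formed from the colors below the twist.\<close>

lemma disp_twist:
  assumes "x \<in> Q" "y \<in> Q" "z \<in> Q"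
  shows "disp (y, x) z \<triangleright> x = z \<triangleright> (y \<triangleright> x)"
  using assms self_distrib[of "z \<triangleleft> x" y x] by (simp add: disp_def rdiv_closed rdiv_mult)

end

context medial_quandle
begin

text \<open>Multiplied by \<open>b\<close>, both sides become products of two products, \<open>(z
  \<triangleright> a) \<triangleright> (c \<triangleright> b)\<close> and \<open>(z \<triangleright>
  c) \<triangleright> (a \<triangleright> b)\<close>, which the medial law identifies. This is the
  only place where that law is applied directly.\<close>

lemma mult_rdiv_mult_commute:
  assumes "a \<in> Q" "b \<in> Q" "c \<in> Q" "z \<in> Q"
  shows "((z \<triangleright> a) \<triangleleft> b) \<triangleright> c = ((z \<triangleright> c) \<triangleleft> b) \<triangleright> a"
proof -
  have "(((z \<triangleright> a) \<triangleleft> b) \<triangleright> c) \<triangleright> b = (z \<triangleright> a) \<triangleright> (c \<triangleright> b)"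
    using assms self_distrib[of "(z \<triangleright> a) \<triangleleft> b" c b] by (simp add: closed rdiv_closed rdiv_mult)
  also have "\<dots> = (z \<triangleright> c) \<triangleright> (a \<triangleright> b)"
    using assms medial by simp
  also have "\<dots> = (((z \<triangleright> c) \<triangleleft> b) \<triangleright> a) \<triangleright> b"
    using assms self_distrib[of "(z \<triangleright> c) \<triangleleft> b" a b] by (simp add: closed rdiv_closed rdiv_mult)
  finally show ?thesis
    using assms by (meson closed mult_cancel rdiv_closed)
qed

text \<open>Both sides are inverse images of \<open>z\<close> under the two maps that the preceding
  lemma shows to be equal.\<close>

lemma rdiv_mult_rdiv_commute:
  assumes "a \<in> Q" "b \<in> Q" "c \<in> Q" "z \<in> Q"
  shows "((z \<triangleleft> a) \<triangleright> b) \<triangleleft> c = ((z \<triangleleft> c) \<triangleright> b) \<triangleleft> a"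
proof -
  let ?w = "((z \<triangleleft> a) \<triangleright> b) \<triangleleft> c"
  have "((?w \<triangleright> a) \<triangleleft> b) \<triangleright> c = z"
    using assms mult_rdiv_mult_commute[of a b c ?w]
    by (simp add: closed rdiv_closed rdiv_mult mult_rdiv)
  then have "z \<triangleleft> c = (?w \<triangleright> a) \<triangleleft> b"
    using assms by (metis closed mult_rdiv rdiv_closed)
  then show ?thesis
    using assms by (simp add: closed rdiv_closed rdiv_mult mult_rdiv)
qed

lemma disp_commute: "disp p (disp q z) = disp q (disp p z)"
proof (cases "fst p \<in> Q \<and> snd p \<in> Q \<and> fst q \<in> Q \<and> snd q \<in> Q \<and> z \<in> Q")
  case True
  obtain a b c d where pq: "p = (a, b)" "q = (c, d)"
    by (metis surj_pair)
  have "(((z \<triangleleft> d) \<triangleright> c) \<triangleleft> b) \<triangleright> a = (((z \<triangleleft> d) \<triangleright> a) \<triangleleft> b) \<triangleright> c"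
    using True pq by (simp add: mult_rdiv_mult_commute rdiv_closed)
  also have "\<dots> = (((z \<triangleleft> b) \<triangleright> a) \<triangleleft> d) \<triangleright> c"
    using True pq by (simp add: rdiv_mult_rdiv_commute)
  finally show ?thesis
    using True pq by (simp add: disp_def closed rdiv_closed)
qed (auto simp: disp_def closed rdiv_closed)

sublocale disp: comp_fun_commute disp
  by unfold_locales (auto simp: fun_eq_iff disp_commute)

text \<open>Displacements generate an abelian group, so a multiset of pairs names an element of it;
  multiset union is composition and \<open>prod.swap\<close> gives inverses.\<close>

definition act :: "('a \<times> 'a) multiset \<Rightarrow> 'a \<Rightarrow> 'a" where
  "act M z = fold_mset disp z M"

lemma act_empty [simp]: "act {#} z = z"
  by (simp add: act_def)

lemma act_add_mset [simp]: "act (add_mset p M) z = disp p (act M z)"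
  by (simp add: act_def)

lemma act_plus: "act (M + N) z = act M (act N z)"
  by (induction M) auto

lemma act_closed: "z \<in> Q \<Longrightarrow> act M z \<in> Q"
  by (induction M) (auto simp: disp_closed)

lemma act_disp: "act M (disp p z) = disp p (act M z)"
  by (induction M) (auto simp: disp_commute)

lemma act_swap: "act (image_mset prod.swap M) (act M z) = z"
  by (induction M) (simp_all add: act_disp disp_swap disp_commute[of _ "prod.swap _"])

text \<open>A displacement is an automorphism of \<open>Q\<close>, so the left-hand side is the
  conjugate of \<open>disp (x, y)\<close> by \<open>disp p\<close>, and conjugation is trivial since
  displacements commute.\<close>

lemma disp_disp:
  assumes "x \<in> Q" "y \<in> Q"
  shows "disp (disp p x, disp p y) = disp (x, y)"
proof
  fix z
  show "disp (disp p x, disp p y) z = disp (x, y) z"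
  proof (cases "z \<in> Q")
    case True
    define w where "w = disp (prod.swap p) z"
    have w: "w \<in> Q" "z = disp p w"
      using True disp_swap[of "prod.swap p" z] by (simp_all add: w_def disp_closed)
    have "disp (disp p x, disp p y) z = disp p (disp (x, y) w)"
      using w assms by (simp add: disp_eq disp_closed disp_mult disp_rdiv rdiv_closed)
    also have "\<dots> = disp (x, y) z"
      using w disp_commute by simp
    finally show ?thesis .
  qed (simp add: disp_def)
qed

lemma disp_act: "x \<in> Q \<Longrightarrow> y \<in> Q \<Longrightarrow> disp (act M x, act M y) = disp (x, y)"
  by (induction M) (auto simp: disp_disp act_closed)

end

section \<open>Relaxed colorings\<close>

text \<open>A vertex sees its incoming edges at their ends (\<open>ct\<close>) and its outgoing
  edges at their starts (\<open>cs\<close>). For \<open>cs = ct\<close> this is the usual crossing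
  relation together with constancy along the over-strand.\<close>

fun (in quandle) vertex_ok :: "(nat \<Rightarrow> 'a) \<Rightarrow> (nat \<Rightarrow> 'a) \<Rightarrow> vertex \<Rightarrow> bool" where
  "vertex_ok cs ct (Crossing s oi oo ui uo) \<longleftrightarrow>
     ct oi = cs oo \<and> (if s then cs uo = ct ui \<triangleright> ct oi else ct ui = cs uo \<triangleright> ct oi)"
| "vertex_ok cs ct (Joint e e') \<longleftrightarrow> ct e = cs e'"

lemma (in quandle) vertex_ok_replace_in:
  "vertex_ok cs ct (replace_in e e' v) \<longleftrightarrow> vertex_ok cs (ct(e := ct e')) v"
  by (cases v) simp_all

text \<open>Makes every edge belong to at most one pair, and to one fixed side of it, so that its
  jump is given by a single value of \<open>d\<close>. Equal pairs are included in the last clause,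
  which gives \<open>a \<noteq> b\<close>.\<close>

definition matching :: "nat set \<Rightarrow> (nat \<times> nat) set \<Rightarrow> bool" where
  "matching E P \<longleftrightarrow> finite P \<and> P \<subseteq> E \<times> E \<and>
     (\<forall>a b c d. (a, b) \<in> P \<longrightarrow> (c, d) \<in> P \<longrightarrow> a \<noteq> d \<and> (a = c \<longleftrightarrow> b = d))"

lemma matching_subset: "matching E P \<Longrightarrow> P' \<subseteq> P \<Longrightarrow> matching E P'"
  unfolding matching_def by (blast intro: finite_subset)

lemma matchingD:
  assumes "matching E P" "(a, b) \<in> P"
  shows "a \<in> E" "b \<in> E" "a \<noteq> b"
  using assms unfolding matching_def by blast+

lemma matching_unique:
  assumes "matching E P" "(a, b) \<in> P" "(c, d) \<in> P"
  shows "a \<noteq> d" "b \<noteq> c" "a = c \<longleftrightarrow> b = d"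
  using assms unfolding matching_def by metis+

lemma matching_split:
  assumes "matching E P" "(e, f) \<in> P" "e' \<notin> E" "f' \<notin> E" "e' \<noteq> f'"
  shows "matching (insert e' (insert f' E)) (P - {(e, f)} \<union> {(e, f'), (e', f)})"
proof -
  have others: "a \<noteq> e" "a \<noteq> f" "b \<noteq> e" "b \<noteq> f" "a \<noteq> e'" "a \<noteq> f'" "b \<noteq> e'" "b \<noteq> f'"
    if "(a, b) \<in> P" "(a, b) \<noteq> (e, f)" for a b
    using that matchingD[OF assms(1), of a b] matching_unique[OF assms(1,2), of a b] assms
    by auto
  have ne: "e \<noteq> f" "e \<noteq> e'" "e \<noteq> f'" "f \<noteq> e'" "f \<noteq> f'"
    using matchingD[OF assms(1,2)] assms by auto
  show ?thesis
    unfolding matching_def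
  proof (intro conjI allI impI)
    show "finite (P - {(e, f)} \<union> {(e, f'), (e', f)})"
      using assms(1) by (simp add: matching_def)
    show "P - {(e, f)} \<union> {(e, f'), (e', f)} \<subseteq> insert e' (insert f' E) \<times> insert e' (insert f' E)"
      using assms(1,2) by (auto simp: matching_def)
  next
    fix a b c d
    assume "(a, b) \<in> P - {(e, f)} \<union> {(e, f'), (e', f)}"
      and "(c, d) \<in> P - {(e, f)} \<union> {(e, f'), (e', f)}"
    then consider "(a, b) \<in> P" "(a, b) \<noteq> (e, f)" "(c, d) \<in> P" "(c, d) \<noteq> (e, f)"
      | "(a, b) \<in> P" "(a, b) \<noteq> (e, f)" "(c, d) \<in> {(e, f'), (e', f)}"
      | "(a, b) \<in> {(e, f'), (e', f)}" "(c, d) \<in> P" "(c, d) \<noteq> (e, f)"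
      | "(a, b) \<in> {(e, f'), (e', f)}" "(c, d) \<in> {(e, f'), (e', f)}"
      by blast
    then have "a \<noteq> d \<and> (a = c \<longleftrightarrow> b = d)"
    proof cases
      case 1
      then show ?thesis using assms(1) by (simp add: matching_def)
    next
      case 2
      then show ?thesis using others[OF 2(1,2)] by auto
    next
      case 3
      then show ?thesis using others[OF 3(2,3)] by auto
    next
      case 4
      then show ?thesis using ne assms(5) by auto
    qed
    then show "a \<noteq> d" "a = c \<longleftrightarrow> b = d"
      by blast+
  qed
qed

context medial_quandle
begin

text \<open>The edge \<open>e\<close> has color \<open>cs e\<close> at its start and \<open>ct e\<close> at its end. Along a parallel pair \<open>p\<close> both
  strands are shifted by \<open>d p\<close> in path direction, which for strand 2 is against the orientation.\<close>

definition relaxed ::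
  "two_strand_diagram \<Rightarrow> (nat \<times> nat) set \<Rightarrow> (nat \<times> nat \<Rightarrow> ('a \<times> 'a) multiset) \<Rightarrow>
   (nat \<Rightarrow> 'a) \<Rightarrow> (nat \<Rightarrow> 'a) \<Rightarrow> bool" where
  "relaxed D P d cs ct \<longleftrightarrow>
     (\<forall>e\<in>edges D. cs e \<in> Q \<and> ct e \<in> Q) \<and>
     (\<forall>v\<in>verts D. vertex_ok cs ct v) \<and>
     (\<forall>e\<in>edges D - Field P. ct e = cs e) \<and>
     (\<forall>(e, f)\<in>P. ct e = act (d (e, f)) (cs e) \<and> cs f = act (d (e, f)) (ct f))"

text \<open>The last clause reads a pair where the path enters it, which is the start of its edge on
  strand 1 but the end of its edge on strand 2. It is carried along because types 2 and 2' compare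
  the displacements of two different pairs.\<close>

definition balanced :: "two_strand_diagram \<Rightarrow> (nat \<times> nat) set \<Rightarrow> bool" where
  "balanced D P \<longleftrightarrow> (\<forall>d cs ct. relaxed D P d cs ct \<longrightarrow>
     ct (snk1 D) = act (\<Sum>p\<in>P. d p) (cs (src1 D)) \<and>
     cs (src2 D) = act (\<Sum>p\<in>P. d p) (ct (snk2 D)) \<and>
     (\<forall>(e, f)\<in>P. disp (cs e, ct f) = disp (cs (src1 D), ct (snk2 D))))"

lemma balanced_subdivide_pair:
  assumes bal: "balanced D P" and mat: "matching (edges D) P"
    and ef: "(e, f) \<in> P" "e' \<notin> edges D" "f' \<notin> edges D" "e' \<noteq> f'"
  shows "balanced (subdivide e e' (subdivide f f' D)) (P - {(e, f)} \<union> {(e, f'), (e', f)})"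
    (is "balanced ?D ?P")
  unfolding balanced_def
proof (intro allI impI)
  fix d cs ct
  assume rel: "relaxed ?D ?P d cs ct"
  have e: "e \<in> edges D" "f \<in> edges D" "e \<noteq> f" "e \<noteq> e'" "e \<noteq> f'" "f \<noteq> e'" "f \<noteq> f'"
    using matchingD[OF mat ef(1)] ef by auto
  have others: "a \<noteq> e" "a \<noteq> f" "b \<noteq> e" "b \<noteq> f" "a \<noteq> e'" "a \<noteq> f'" "b \<noteq> e'" "b \<noteq> f'"
    if "(a, b) \<in> P" "(a, b) \<noteq> (e, f)" for a b
    using that matchingD[OF mat, of a b] matching_unique[OF mat ef(1), of a b] ef by auto
  \<comment> \<open>The joints are removed: \<open>e\<close> and \<open>f\<close> take over the end
    colors of their second halves. Since \<open>f\<close> runs against the path, its second half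
    lies beside the first half of \<open>e\<close>, and the merged pair jumps by the sum of both
    jumps.\<close>
  define ct' where "ct' = ct(e := ct e', f := ct f')"
  define d' where "d' = d((e, f) := d (e', f) + d (e, f'))"
  have verts: "vertex_ok cs ct v" if "v \<in> insert (Joint e e')
      (replace_in e e' ` insert (Joint f f') (replace_in f f' ` verts D))" for v
    using rel that by (auto simp: relaxed_def subdivide_def)
  have J: "ct e = cs e'" "ct f = cs f'"
    using verts[of "Joint e e'"] verts[of "Joint f f'"] e by auto
  have sh: "ct a = act (d (a, b)) (cs a)" "cs b = act (d (a, b)) (ct b)" if "(a, b) \<in> ?P" for a b
    using rel that by (auto simp: relaxed_def)
  have "relaxed D P d' cs ct'"
    unfolding relaxed_def
  proof (intro conjI ballI)
    fix a assume "a \<in> edges D"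
    then show "cs a \<in> Q" "ct' a \<in> Q"
      using rel by (auto simp: relaxed_def ct'_def subdivide_def)
  next
    fix v assume "v \<in> verts D"
    then have "vertex_ok cs ct (replace_in e e' (replace_in f f' v))"
      using verts by blast
    then have "vertex_ok cs (ct(e := ct e', f := (ct(e := ct e')) f')) v"
      by (simp only: vertex_ok_replace_in)
    then show "vertex_ok cs ct' v"
      using e by (simp add: ct'_def)
  next
    fix a assume a: "a \<in> edges D - Field P"
    then have "a \<noteq> e" "a \<noteq> f" "a \<notin> Field ?P" "a \<in> edges ?D"
      using ef by (auto simp: Field_def subdivide_def)
    then show "ct' a = cs a"
      using rel by (simp add: relaxed_def ct'_def)
  next
    fix p assume p: "p \<in> P"
    show "case p of (a, b) \<Rightarrow> ct' a = act (d' (a, b)) (cs a) \<and> cs b = act (d' (a, b)) (ct' b)"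
    proof (cases "p = (e, f)")
      case True
      have "ct e' = act (d (e', f)) (act (d (e, f')) (cs e))"
        using sh[of e f'] sh[of e' f] J by simp
      moreover have "cs f = act (d (e', f)) (act (d (e, f')) (ct f'))"
        using sh[of e f'] sh[of e' f] J by simp
      ultimately show ?thesis
        using True e by (simp add: ct'_def d'_def act_plus)
    next
      case False
      then show ?thesis
        using p sh[of "fst p" "snd p"] others[of "fst p" "snd p"]
        by (simp add: ct'_def d'_def split_beta)
    qed
  qed
  then have concl: "ct' (snk1 D) = act (\<Sum>p\<in>P. d' p) (cs (src1 D))"
      "cs (src2 D) = act (\<Sum>p\<in>P. d' p) (ct' (snk2 D))"
      "\<And>a b. (a, b) \<in> P \<Longrightarrow> disp (cs a, ct' b) = disp (cs (src1 D), ct' (snk2 D))"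
    using bal unfolding balanced_def by blast+
  have fin: "finite P"
    using mat by (simp add: matching_def)
  have new: "(e, f') \<notin> P" "(e', f) \<notin> P"
    using matchingD[OF mat] ef by blast+
  have "(\<Sum>p\<in>P. d' p) = d' (e, f) + (\<Sum>p\<in>P - {(e, f)}. d' p)"
    using fin ef by (simp add: sum.remove)
  also have "(\<Sum>p\<in>P - {(e, f)}. d' p) = (\<Sum>p\<in>P - {(e, f)}. d p)"
    by (intro sum.cong) (auto simp: d'_def)
  finally have sum: "(\<Sum>p\<in>P. d' p) = (\<Sum>p\<in>?P. d p)"
    using fin new e by (simp add: d'_def ac_simps)
  have snk: "ct' (snk1 D) = ct (snk1 ?D)" "ct' (snk2 D) = ct (snk2 ?D)"
    and src: "src1 ?D = src1 D" "src2 ?D = src2 D"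
    using e by (auto simp: ct'_def subdivide_def)
  have "disp (cs a, ct b) = disp (cs (src1 D), ct' (snk2 D))" if ab: "(a, b) \<in> ?P" for a b
  proof -
    consider "(a, b) = (e, f')" | "(a, b) = (e', f)" | "(a, b) \<in> P" "(a, b) \<noteq> (e, f)"
      using ab by blast
    then show ?thesis
    proof cases
      case 1
      then show ?thesis using concl(3)[of e f] ef e by (simp add: ct'_def)
    next
      case 2
      \<comment> \<open>The path enters the second half with both colors moved by the jump of the
        first half, which leaves the displacement unchanged.\<close>
      have "cs e \<in> Q" "ct f' \<in> Q"
        using rel e by (auto simp: relaxed_def subdivide_def)
      then have "disp (cs e', ct f) = disp (cs e, ct f')"
        using sh[of e f'] J by (simp add: disp_act)
      then show ?thesis using 2 concl(3)[of e f] ef e by (simp add: ct'_def)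
    next
      case 3
      have "ct' b = ct b"
        using others(3,4)[OF 3] by (simp add: ct'_def)
      then show ?thesis
        using concl(3)[OF 3(1)] by simp
    qed
  qed
  then have "\<forall>(a, b)\<in>?P. disp (cs a, ct b) = disp (cs (src1 ?D), ct (snk2 ?D))"
    unfolding snk src by blast
  then show "ct (snk1 ?D) = act (\<Sum>p\<in>?P. d p) (cs (src1 ?D)) \<and>
     cs (src2 ?D) = act (\<Sum>p\<in>?P. d p) (ct (snk2 ?D)) \<and>
     (\<forall>(a, b)\<in>?P. disp (cs a, ct b) = disp (cs (src1 ?D), ct (snk2 ?D)))"
    using concl(1,2) unfolding sum snk src by blast
qed

end

section \<open>The four structures\<close>

fun last_twisted :: "move_type \<Rightarrow> nat" where
  "last_twisted Type1 = 2"
| "last_twisted Type1' = 2"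
| "last_twisted Type2 = 3"
| "last_twisted Type2' = 3"

lemma twisted_eq: "twisted ty = {1..last_twisted ty}"
  by (cases ty) auto

context medial_quandle
begin

text \<open>These are the colors \<open>y'\<close> and \<open>x'\<close> of a twist of type 1; type
  1' exchanges the roles of \<open>x\<close> and \<open>y\<close>. The second equation comes from
  the first because the displacement preserves the operation and sends
  \<open>x \<triangleright> y\<close> to \<open>x\<close>.\<close>

lemma disp_pair:
  assumes "x \<in> Q" "y \<in> Q"
  shows "disp (x, y) y = y \<triangleright> x" "disp (x, y) x = x \<triangleleft> (y \<triangleright> x)"
proof -
  show y: "disp (x, y) y = y \<triangleright> x"
    using assms by (simp add: disp_eq rdiv_idem)
  have "disp (x, y) x \<triangleright> (y \<triangleright> x) = disp (x, y) (x \<triangleright> y)"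
    using assms y by (simp add: disp_mult)
  also have "\<dots> = x"
    using assms by (simp add: disp_eq closed mult_rdiv idem)
  finally show "disp (x, y) x = x \<triangleleft> (y \<triangleright> x)"
    using assms by (intro rdiv_eqI[symmetric] disp_closed closed)
qed

lemma rdiv_eq_disp:
  assumes "x \<in> Q" "y \<in> Q" "z \<in> Q"
  shows "(z \<triangleright> (y \<triangleright> x)) \<triangleleft> x = disp (y, x) z"
  using assms disp_twist by (simp add: rdiv_eqI disp_closed)

text \<open>Here \<open>u\<close> is measured upwards and \<open>w\<close> to the right, whatever
  the path directions are. The upper end of the vertical shift is taken at the bottom of height
  \<open>Suc t\<close>: for \<open>t = 2\<close> the piece at height 3 is again a parallel pair and
  may have a jump of its own. The last clause then says that the vertical strands keep their colors
  when they pass over the upper horizontal strand.\<close>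

definition shift ::
  "(nat \<Rightarrow> nat) \<Rightarrow> (nat \<Rightarrow> nat) \<Rightarrow> (nat \<Rightarrow> nat) \<Rightarrow> (nat \<Rightarrow> nat) \<Rightarrow> nat \<Rightarrow> (nat \<Rightarrow> 'a) \<Rightarrow> (nat \<Rightarrow> 'a) \<Rightarrow>
   ('a \<times> 'a) multiset \<Rightarrow> ('a \<times> 'a) multiset \<Rightarrow> bool" where
  "shift l r h k t cs ct u w \<longleftrightarrow>
     cs (r (Suc t)) = act u (ct (r 0)) \<and> ct (l (Suc t)) = act u (cs (l 0)) \<and>
     cs (h 2) = act w (ct (h 0)) \<and> ct (k 2) = act w (cs (k 0)) \<and>
     (t = 2 \<longrightarrow> ct (l 4) = cs (l 3) \<and> ct (r 3) = cs (r 4))"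

text \<open>In types 1 and 1' the upper horizontal strand passes under the top of height 3, above a
  possible jump there; \<open>top\<close> lets its displacement be computed from the colors below
  that jump. In types 2 and 2' the assumed equality of the displacements of the two pairs makes
  \<open>u\<close> act trivially.\<close>

lemma shift_structure:
  assumes cr: "\<forall>v\<in>structure_crossings ty l r h k. vertex_ok cs ct v"
    and lr: "\<And>i. i < 5 \<Longrightarrow> cs (l i) \<in> Q \<and> ct (l i) \<in> Q \<and> cs (r i) \<in> Q \<and> ct (r i) \<in> Q"
    and hk: "\<And>i. i < 3 \<Longrightarrow> cs (h i) \<in> Q \<and> ct (h i) \<in> Q \<and> cs (k i) \<in> Q \<and> ct (k i) \<in> Q"
    and tw: "\<And>i. i \<in> twisted ty \<Longrightarrow> ct (l i) = cs (l i) \<and> ct (r i) = cs (r i)"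
    and mid: "ct (h 1) = cs (h 1)" "ct (k 1) = cs (k 1)"
    and top: "disp (ct (r 3), cs (l 3)) = disp (cs (r 3), ct (l 3))"
  obtains u w where "shift l r h k (last_twisted ty) cs ct u w"
    "\<And>up right z. directional ty up right \<Longrightarrow>
       (if up then disp (ct (r 0), cs (l 0)) else disp (cs (l 0), ct (r 0))) =
       (if right then disp (ct (h 0), cs (k 0)) else disp (cs (k 0), ct (h 0))) \<Longrightarrow>
       act ((if up then u else image_mset prod.swap u) +
            (if right then w else image_mset prod.swap w)) z = z"
proof -
  note inQ = lr[of 0, simplified] lr[of 1, simplified] lr[of 2, simplified] lr[of 3, simplified]
    lr[of 4, simplified] hk[of 0, simplified] hk[of 1, simplified] hk[of 2, simplified]
  have mid: "ct (h (Suc 0)) = cs (h (Suc 0))" "ct (k (Suc 0)) = cs (k (Suc 0))"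
    using mid by simp_all
  have sw: "disp (a, b) (disp (b, a) z) = z" for a b z
    using disp_swap[of "(b, a)"] by simp
  have sw': "disp (a, b) = disp (c, d) \<Longrightarrow> disp (c, d) (disp (b, a) z) = z" for a b c d z
    using sw[of a b] by simp
  define x where "x = cs (l 0)"
  define y where "y = ct (r 0)"
  have xy: "x \<in> Q" "y \<in> Q"
    using inQ by (simp_all add: x_def y_def)
  show thesis
  proof (cases ty)
    case Type1
    note cr = cr[unfolded Type1, simplified]
    have t: "ct (l (Suc 0)) = cs (l (Suc 0))" "ct (l 2) = cs (l 2)" "ct (r (Suc 0)) = cs (r (Suc 0))" "ct (r 2) = cs (r 2)"
      using tw[of 1] tw[of 2] Type1 by auto
    have "cs (r 3) = y \<triangleright> x"
      using cr t unfolding x_def y_def by metis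
    then have r3: "cs (r 3) = disp (x, y) y"
      using xy by (simp add: disp_pair)
    have "x = ct (l 3) \<triangleright> cs (r 3)"
      using cr t unfolding x_def y_def by metis
    then have "ct (l 3) = x \<triangleleft> cs (r 3)"
      using inQ mult_eqD by blast
    then have l3: "ct (l 3) = disp (x, y) x"
      using r3 xy by (simp add: disp_pair)
    have "cs (h 2) \<triangleright> x = ct (h 0) \<triangleright> (y \<triangleright> x)"
      using cr t mid unfolding x_def y_def by metis
    then have h2: "cs (h 2) = disp (y, x) (ct (h 0))"
      using inQ xy by (metis mult_eqD rdiv_eq_disp)
    have "cs (k 0) = cs (k (Suc 0)) \<triangleright> cs (l 3)"
      using cr mid by simp
    then have k1: "cs (k (Suc 0)) = cs (k 0) \<triangleleft> cs (l 3)"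
      using inQ by (intro mult_eqD) auto
    have "ct (k 2) = cs (k (Suc 0)) \<triangleright> ct (r 3)"
      using cr by simp
    also have "\<dots> = disp (ct (r 3), cs (l 3)) (cs (k 0))"
      using inQ by (simp add: k1 disp_eq)
    also have "\<dots> = disp (y, x) (cs (k 0))"
      using xy by (simp add: top r3 l3 disp_disp)
    finally have k2: "ct (k 2) = disp (y, x) (cs (k 0))" .
    show thesis
      \<comment> \<open>Upwards and to the right the shifts are inverse to each other, and they
        remain so if both directions are reversed, as happens for \<open>up = right\<close>.\<close>
      by (rule that[of "{#(x, y)#}" "{#(y, x)#}"])
         (use Type1 r3 l3 h2 k2 cr sw in \<open>auto simp: shift_def x_def y_def split: if_splits\<close>)
  next
    case Type1'
    note cr = cr[unfolded Type1', simplified]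
    have t: "ct (l (Suc 0)) = cs (l (Suc 0))" "ct (l 2) = cs (l 2)" "ct (r (Suc 0)) = cs (r (Suc 0))" "ct (r 2) = cs (r 2)"
      using tw[of 1] tw[of 2] Type1' by auto
    have "ct (l 3) = x \<triangleright> y"
      using cr t unfolding x_def y_def by metis
    then have l3: "ct (l 3) = disp (y, x) x"
      using xy by (simp add: disp_pair)
    have "y = cs (r 3) \<triangleright> ct (l 3)"
      using cr t unfolding x_def y_def by metis
    then have "cs (r 3) = y \<triangleleft> ct (l 3)"
      using inQ mult_eqD by blast
    then have r3: "cs (r 3) = disp (y, x) y"
      using l3 xy by (simp add: disp_pair)
    have "cs (h 2) \<triangleright> (x \<triangleright> y) = ct (h 0) \<triangleright> y"
      using cr t mid unfolding x_def y_def by metis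
    moreover have "disp (y, x) (ct (h 0)) \<triangleright> (x \<triangleright> y) = ct (h 0) \<triangleright> y"
      using inQ xy disp_twist[of y x "disp (y, x) (ct (h 0))"] by (simp add: sw disp_closed)
    ultimately have h2: "cs (h 2) = disp (y, x) (ct (h 0))"
      using inQ xy by (metis closed disp_closed mult_cancel)
    have "cs (k 0) = cs (k (Suc 0)) \<triangleright> cs (l 3)"
      using cr mid by simp
    then have k1: "cs (k (Suc 0)) = cs (k 0) \<triangleleft> cs (l 3)"
      using inQ by (intro mult_eqD) auto
    have "ct (k 2) = cs (k (Suc 0)) \<triangleright> ct (r 3)"
      using cr by simp
    also have "\<dots> = disp (ct (r 3), cs (l 3)) (cs (k 0))"
      using inQ by (simp add: k1 disp_eq)
    also have "\<dots> = disp (y, x) (cs (k 0))"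
      using xy by (simp add: top r3 l3 disp_disp)
    finally have k2: "ct (k 2) = disp (y, x) (cs (k 0))" .
    show thesis
      \<comment> \<open>Upwards and to the right the shifts are equal, so they cancel when exactly
        one direction is reversed.\<close>
      by (rule that[of "{#(y, x)#}" "{#(y, x)#}"])
         (use Type1' r3 l3 h2 k2 cr sw in \<open>auto simp: shift_def x_def y_def split: if_splits\<close>)
  next
    case Type2
    note cr = cr[unfolded Type2, simplified]
    have t: "ct (l (Suc 0)) = cs (l (Suc 0))" "ct (l 2) = cs (l 2)" "ct (l 3) = cs (l 3)"
      "ct (r (Suc 0)) = cs (r (Suc 0))" "ct (r 2) = cs (r 2)" "ct (r 3) = cs (r 3)"
      using tw[of 1] tw[of 2] tw[of 3] Type2 by auto
    define m where "m = ct (h 0)"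
    define n where "n = cs (k 0)"
    have mn: "m \<in> Q" "n \<in> Q"
      using inQ by (simp_all add: m_def n_def)
    have "y \<triangleright> x = cs (r 2) \<triangleright> m" and r3: "cs (r 3) = cs (r 2)"
      using cr t mid unfolding x_def y_def m_def by metis+
    then have r2: "cs (r 2) = (y \<triangleright> x) \<triangleleft> m"
      using inQ mn by (intro mult_eqD) auto
    have l2: "x = cs (l 2) \<triangleright> m" "cs (l 2) = cs (l 3) \<triangleright> cs (r 2)"
      using cr t mid unfolding x_def m_def by metis+
    \<comment> \<open>Multiplication by \<open>m\<close> distributes over the second crossing of the
      twist, so the colors multiplied by \<open>m\<close> are those of a full twist without
      \<open>m\<close> in between. The vertical pair is therefore moved by
      \<open>disp (x, y)\<close> and then, going under \<open>m\<close> and \<open>n\<close>, by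
      \<open>disp (n, m)\<close>.\<close>
    have "x = (cs (l 3) \<triangleright> m) \<triangleright> (y \<triangleright> x)"
      using l2 inQ mn xy r2 by (simp add: self_distrib[of _ _ m] closed rdiv_mult)
    then have "cs (l 3) \<triangleright> m = x \<triangleleft> (y \<triangleright> x)"
      using inQ mn xy by (intro mult_eqD closed) auto
    then have "cs (l 3) \<triangleright> m = disp (x, y) x"
      using xy by (simp add: disp_pair)
    then have l3: "cs (l 3) = disp (x, y) x \<triangleleft> m"
      using inQ mn by (intro mult_eqD) auto
    have "cs (r 4) = cs (r 2) \<triangleright> n" "ct (l 4) = cs (l 3) \<triangleright> n"
      using cr t mid r3 unfolding n_def by metis+
    then have "cs (r 4) = disp (n, m) (disp (x, y) y)" "ct (l 4) = disp (n, m) (disp (x, y) x)"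
      using xy mn r2 l3 by (simp_all add: disp_pair) (simp_all add: disp_eq closed rdiv_closed)
    moreover have "cs (h 2) = m" "ct (k 2) = n"
      using cr mid unfolding m_def n_def by metis+
    ultimately show thesis
      \<comment> \<open>The horizontal strands pass over and keep their colors, hence the empty
        shift.\<close>
      by (intro that[of "{#(n, m), (x, y)#}" "{#}"])
         (use Type2 sw' in
           \<open>auto simp: shift_def x_def y_def m_def n_def split: if_splits\<close>)
  next
    case Type2'
    note cr = cr[unfolded Type2', simplified]
    have t: "ct (l (Suc 0)) = cs (l (Suc 0))" "ct (l 2) = cs (l 2)" "ct (l 3) = cs (l 3)"
      "ct (r (Suc 0)) = cs (r (Suc 0))" "ct (r 2) = cs (r 2)" "ct (r 3) = cs (r 3)"
      using tw[of 1] tw[of 2] tw[of 3] Type2' by auto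
    define m where "m = ct (h 0)"
    define n where "n = cs (k 0)"
    have mn: "m \<in> Q" "n \<in> Q"
      using inQ by (simp_all add: m_def n_def)
    have "x \<triangleright> y = cs (l 2) \<triangleright> m" and l3: "cs (l 3) = cs (l 2)"
      using cr t mid unfolding x_def y_def m_def by metis+
    then have l2: "cs (l 2) = (x \<triangleright> y) \<triangleleft> m"
      using inQ mn by (intro mult_eqD) auto
    have r2: "y = cs (r 2) \<triangleright> m" "cs (r 2) = cs (r 3) \<triangleright> cs (l 2)"
      using cr t mid unfolding y_def m_def by metis+
    have "y = (cs (r 3) \<triangleright> m) \<triangleright> (x \<triangleright> y)"
      using r2 inQ mn xy l2 by (simp add: self_distrib[of _ _ m] closed rdiv_mult)
    then have "cs (r 3) \<triangleright> m = y \<triangleleft> (x \<triangleright> y)"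
      using inQ mn xy by (intro mult_eqD closed) auto
    then have "cs (r 3) \<triangleright> m = disp (y, x) y"
      using xy by (simp add: disp_pair)
    then have r3: "cs (r 3) = disp (y, x) y \<triangleleft> m"
      using inQ mn by (intro mult_eqD) auto
    have "ct (l 4) = cs (l 2) \<triangleright> n" "cs (r 4) = cs (r 3) \<triangleright> n"
      using cr t mid l3 unfolding n_def by metis+
    then have "ct (l 4) = disp (n, m) (disp (y, x) x)" "cs (r 4) = disp (n, m) (disp (y, x) y)"
      using xy mn l2 r3 by (simp_all add: disp_pair) (simp_all add: disp_eq closed rdiv_closed)
    moreover have "cs (h 2) = m" "ct (k 2) = n"
      using cr mid unfolding m_def n_def by metis+
    ultimately show thesis
      by (intro that[of "{#(n, m), (y, x)#}" "{#}"])
         (use Type2' sw' in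
           \<open>auto simp: shift_def x_def y_def m_def n_def split: if_splits\<close>)
  qed
qed

end

section \<open>Inserting a structure into a diagram\<close>

lemma (in quandle) vertex_ok_cong:
  assumes "\<And>e. e \<in> Range (passages v) \<Longrightarrow> cs e = cs' e"
    and "\<And>e. e \<in> Domain (passages v) \<Longrightarrow> ct e = ct' e"
  shows "vertex_ok cs ct v \<longleftrightarrow> vertex_ok cs' ct' v"
  using assms by (cases v) auto

lemma matching_along_unique:
  assumes "matching E P" "along b x y \<in> P" "p \<in> P" "{fst p, snd p} \<inter> {x, y} \<noteq> {}"
  shows "p = along b x y"
proof -
  obtain a c where p: "p = (a, c)" by force
  obtain x' y' where xy: "along b x y = (x', y')" "{x', y'} = {x, y}"
    by (cases b) (auto simp: along_def)
  have "{a, c} \<inter> {x', y'} \<noteq> {}"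
    using assms(4) p xy by simp
  then show ?thesis
    using matching_unique[OF assms(1), of a c x' y'] assms(2,3) p xy(1) by auto
qed

lemma image_disjointD: "f ` A \<inter> g ` B = {} \<Longrightarrow> i \<in> A \<Longrightarrow> j \<in> B \<Longrightarrow> f i \<noteq> g j \<and> g j \<noteq> f i"
  by blast

lemma well_formed_disjoint:
  assumes "well_formed D" "v \<in> verts D" "w \<in> verts D" "v \<noteq> w"
  shows "Domain (passages v) \<inter> Domain (passages w) = {}"
    and "Range (passages v) \<inter> Range (passages w) = {}"
  using assms unfolding well_formed_def by blast+

text \<open>An edge that both enters and leaves a crossing of the structure is no end edge and, by
  well-formedness, meets no other vertex. Such edges can be recolored without affecting the rest of
  the diagram.\<close>

lemma structure_interior:
  assumes "e \<in> l ` {1..3} \<union> r ` {1..3} \<union> {h 1, k 1}"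
  shows "\<exists>v\<in>structure_crossings ty l r h k. e \<in> Domain (passages v)"
    and "\<exists>v\<in>structure_crossings ty l r h k. e \<in> Range (passages v)"
proof -
  have "{1..3} = {1, 2, 3::nat}" by auto
  then have "e \<in> {l 1, l 2, l 3, r 1, r 2, r 3, h 1, k 1}"
    using assms by auto
  then show "\<exists>v\<in>structure_crossings ty l r h k. e \<in> Domain (passages v)"
    and "\<exists>v\<in>structure_crossings ty l r h k. e \<in> Range (passages v)"
    by (cases ty; auto)+
qed

context medial_quandle
begin

text \<open>A relaxed coloring of \<open>D'\<close> becomes one of \<open>D\<close> by recording the effect of the six crossings as
  shifts of the pair \<open>r 1\<close>, \<open>l 1\<close> and of the pair \<open>h 1\<close>, \<open>k 1\<close>.\<close>

lemma balanced_move: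
  assumes bal: "balanced D P" and mat: "matching (edges D) P"
    and dir: "directional ty up right"
    and dist: "distinct (map l [0..<5] @ map r [0..<5] @ map h [0..<3] @ map k [0..<3])"
    and ver: "\<And>i. i < 5 \<Longrightarrow> along up (r i) (l i) \<in> P"
    and hor: "\<And>i. i < 3 \<Longrightarrow> along right (h i) (k i) \<in> P"
    and loc: "local_change I (structure_joints l r h k) (structure_crossings ty l r h k) D D'"
    and planar: "planar D'"
    and P': "P' = P - ({along up (r i) (l i) | i. i \<in> twisted ty} \<union> {along right (h 1) (k 1)})"
  shows "balanced D' P'"
  unfolding balanced_def
proof (intro allI impI)
  fix d cs ct
  assume rel: "relaxed D' P' d cs ct"
  define t where "t = last_twisted ty"
  have t: "t = 2 \<or> t = 3"
    by (cases ty) (auto simp: t_def)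
  \<comment> \<open>The edges of the pairs lost in the move. They are unpaired in \<open>P'\<close>,
    hence carry a single color, and are the only ones to be recolored.\<close>
  define C where "C = l ` {1..t} \<union> r ` {1..t} \<union> {h 1, k 1}"
  define VP where "VP = (\<lambda>i. along up (r i) (l i)) ` {1..t}"
  define HP where "HP = along right (h 1) (k 1)"
  have P'_eq: "P' = P - (VP \<union> {HP})"
    unfolding P' VP_def HP_def twisted_eq t_def by blast
  have inj: "inj_on l {0..<5}" "inj_on r {0..<5}" "inj_on h {0..<3}" "inj_on k {0..<3}"
    and disj: "l ` {0..<5} \<inter> r ` {0..<5} = {}" "l ` {0..<5} \<inter> h ` {0..<3} = {}"
      "l ` {0..<5} \<inter> k ` {0..<3} = {}" "r ` {0..<5} \<inter> h ` {0..<3} = {}"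
      "r ` {0..<5} \<inter> k ` {0..<3} = {}" "h ` {0..<3} \<inter> k ` {0..<3} = {}"
    using dist
    unfolding distinct_append distinct_map set_append set_map set_upt Int_Un_distrib Un_empty
    by - (elim conjE, assumption)+
  have ne_same: "l i = l j \<longleftrightarrow> i = j" "r i = r j \<longleftrightarrow> i = j" if "i < 5" "j < 5" for i j
    using that inj by (auto simp: inj_on_eq_iff)
  have ne_same': "h i = h j \<longleftrightarrow> i = j" "k i = k j \<longleftrightarrow> i = j" if "i < 3" "j < 3" for i j
    using that inj by (auto simp: inj_on_eq_iff)
  have ne_lr: "l i \<noteq> r j" "r j \<noteq> l i" if "i < 5" "j < 5" for i j
    using that image_disjointD[OF disj(1), of i j] by simp_all
  have ne_vh: "l i \<noteq> h j" "h j \<noteq> l i" "l i \<noteq> k j" "k j \<noteq> l i"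
      "r i \<noteq> h j" "h j \<noteq> r i" "r i \<noteq> k j" "k j \<noteq> r i" if "i < 5" "j < 3" for i j
    using that image_disjointD[OF disj(2), of i j] image_disjointD[OF disj(3), of i j]
      image_disjointD[OF disj(4), of i j] image_disjointD[OF disj(5), of i j] by simp_all
  have ne_hk: "h i \<noteq> k j" "k j \<noteq> h i" if "i < 3" "j < 3" for i j
    using that image_disjointD[OF disj(6), of i j] by simp_all
  note ne = ne_same ne_same' ne_lr ne_vh ne_hk
  have mem: "l i \<in> l ` {a..t} \<longleftrightarrow> i \<in> {a..t}" "r i \<in> r ` {a..t} \<longleftrightarrow> i \<in> {a..t}" if "i < 5" for i a
    using that t by (auto simp: ne_same)
  have nmem: "l i \<notin> r ` {a..t}" "r i \<notin> l ` {a..t}" if "i < 5" for i a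
    using that ne_lr t by auto
  have nmem': "h j \<notin> l ` {a..t}" "h j \<notin> r ` {a..t}" "k j \<notin> l ` {a..t}" "k j \<notin> r ` {a..t}"
    if "j < 3" for j a
    using that ne_vh t by auto
  have sub: "{1..t} \<subseteq> {0..<5}" "{2..t} \<subseteq> {0..<5}"
    using t by auto

  have edges: "edges D' = edges D" and ends: "src1 D' = src1 D" "snk1 D' = snk1 D"
      "src2 D' = src2 D" "snk2 D' = snk2 D"
    and V: "structure_crossings ty l r h k \<subseteq> verts D'"
      "verts D \<subseteq> structure_joints l r h k \<union> (verts D' - structure_crossings ty l r h k)"
    using loc unfolding local_change_def by blast+
  have wf: "well_formed D'"
    using planar by (simp add: planar_def)
  have "C \<subseteq> l ` {1..3} \<union> r ` {1..3} \<union> {h 1, k 1}"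
    unfolding C_def using t by (intro Un_mono image_mono) auto
  then have C_ex: "\<exists>v\<in>structure_crossings ty l r h k. e \<in> Domain (passages v)"
      "\<exists>v\<in>structure_crossings ty l r h k. e \<in> Range (passages v)" if "e \<in> C" for e
    using that structure_interior[of e l r h k ty] by blast+
  have "e \<in> Domain (pass D')" "e \<in> Range (pass D')" if "e \<in> C" for e
    using C_ex[OF that] V(1) unfolding pass_def by blast+
  moreover have "Domain (pass D') = edges D' - {snk1 D, snk2 D}"
      "Range (pass D') = edges D' - {src1 D, src2 D}"
    using planar ends by (simp_all add: planar_def)
  ultimately have ends_C: "src1 D \<notin> C" "src2 D \<notin> C" "snk1 D \<notin> C" "snk2 D \<notin> C"
    by blast+
  have verts_C: "C \<inter> Domain (passages v) = {}" "C \<inter> Range (passages v) = {}"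
    if "v \<in> verts D' - structure_crossings ty l r h k" for v
  proof -
    have "w \<in> verts D' \<and> w \<noteq> v" if "w \<in> structure_crossings ty l r h k" for w
      using that \<open>v \<in> _\<close> V(1) by auto
    then have "Domain (passages w) \<inter> Domain (passages v) = {}"
        "Range (passages w) \<inter> Range (passages v) = {}" if "w \<in> structure_crossings ty l r h k" for w
      using that well_formed_disjoint[OF wf, of w v] \<open>v \<in> _\<close> by simp_all
    then show "C \<inter> Domain (passages v) = {}" "C \<inter> Range (passages v) = {}"
      using C_ex by (meson disjoint_iff)+
  qed

  have in_edges: "l i \<in> edges D" "r i \<in> edges D" if "i < 5" for i
    using ver[OF that] matchingD[OF mat] by (cases up; force simp: along_def)+
  have in_edges': "h i \<in> edges D" "k i \<in> edges D" if "i < 3" for i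
    using hor[OF that] matchingD[OF mat] by (cases right; force simp: along_def)+
  have inQ: "cs e \<in> Q" "ct e \<in> Q" if "e \<in> edges D" for e
    using that rel edges by (auto simp: relaxed_def)
  have VP: "VP \<subseteq> P" and HP: "HP \<in> P"
    using ver hor sub by (auto simp: VP_def HP_def)
  have P'_C: "a \<notin> C" "b \<notin> C" if "(a, b) \<in> P'" for a b
  proof -
    have "(a, b) = HP" if "{a, b} \<inter> {h 1, k 1} \<noteq> {}"
      using matching_along_unique[OF mat hor[of 1], of "(a, b)"] that \<open>(a, b) \<in> P'\<close>
      by (simp add: HP_def P'_eq)
    moreover have "(a, b) \<in> VP" if "{a, b} \<inter> {r i, l i} \<noteq> {}" "i \<in> {1..t}" for i
      using matching_along_unique[OF mat ver[of i], of "(a, b)"] that \<open>(a, b) \<in> P'\<close> sub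
      by (auto simp: VP_def P'_eq)
    ultimately show "a \<notin> C" "b \<notin> C"
      using \<open>(a, b) \<in> P'\<close> unfolding P'_eq C_def by blast+
  qed
  have C_Field: "C \<subseteq> Field P"
  proof -
    have field: "x \<in> Field P" "y \<in> Field P" if "along b x y \<in> P" for b x y
      using that by (cases b; simp add: along_def FieldI1 FieldI2)+
    have "l i \<in> Field P" "r i \<in> Field P" if "i \<le> t" for i
      using field[OF ver[of i]] t that by auto
    moreover have "h 1 \<in> Field P" "k 1 \<in> Field P"
      using field[OF hor[of 1]] by simp_all
    ultimately show ?thesis
      unfolding C_def by auto
  qed
  have unpaired: "ct e = cs e" if "e \<in> C" for e
  proof -
    have "e \<notin> Field P'"
      using P'_C that unfolding Field_def by blast
    moreover have "e \<in> edges D"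
      using that in_edges in_edges' sub unfolding C_def by auto
    ultimately show ?thesis
      using rel edges by (simp add: relaxed_def)
  qed
  have pair: "ct a = act (d (a, b)) (cs a)" "cs b = act (d (a, b)) (ct b)" if "(a, b) \<in> P'" for a b
    using rel that by (auto simp: relaxed_def)

  \<comment> \<open>Either height 3 is still a parallel pair, whose jump moves both colors alike, or
    it belongs to the twist and has no jump.\<close>
  have top: "disp (ct (r 3), cs (l 3)) = disp (cs (r 3), ct (l 3))"
  proof (cases "along up (r 3) (l 3) \<in> P'")
    case True
    then show ?thesis
      using pair[of "r 3" "l 3"] pair[of "l 3" "r 3"] inQ in_edges
      by (cases up) (simp_all add: along_def disp_act)
  next
    case False
    have "along up (r 3) (l 3) \<noteq> HP"
      unfolding HP_def along_def by (auto simp: ne)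
    then have "along up (r 3) (l 3) \<in> VP"
      using False ver[of 3] by (auto simp: P'_eq)
    then have "r 3 \<in> C" "l 3 \<in> C"
      unfolding VP_def C_def along_def by (auto split: if_splits)
    then show ?thesis
      using unpaired by simp
  qed
  have "\<forall>v\<in>structure_crossings ty l r h k. vertex_ok cs ct v"
    using rel V(1) by (auto simp: relaxed_def)
  then obtain u w where sh: "shift l r h k t cs ct u w"
    and cancel: "\<And>up right z. directional ty up right \<Longrightarrow>
       (if up then disp (ct (r 0), cs (l 0)) else disp (cs (l 0), ct (r 0))) =
       (if right then disp (ct (h 0), cs (k 0)) else disp (cs (k 0), ct (h 0))) \<Longrightarrow>
       act ((if up then u else image_mset prod.swap u) +
            (if right then w else image_mset prod.swap w)) z = z"
    unfolding t_def
    by (rule shift_structure[of ty l r h k cs ct])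
       (use inQ in_edges in_edges' unpaired top in
         \<open>auto simp: C_def t_def twisted_eq\<close>)

  \<comment> \<open>The shifts are converted from upwards and rightwards to the path
    direction.\<close>
  define U where "U = (if up then u else image_mset prod.swap u)"
  define W where "W = (if right then w else image_mset prod.swap w)"
  \<comment> \<open>The whole vertical shift is put on the pair at height 1. The pieces at heights 2
    to \<open>t\<close> already carry the colors above the shift and are constant, so every joint
    fits; the horizontal shift is put on \<open>h 1\<close> and \<open>k 1\<close>.\<close>
  define cs' where "cs' e =
    (if e \<in> l ` {1..t} then ct (l (Suc t)) else if e = r 1 then ct (r 0)
     else if e \<in> r ` {2..t} then cs (r (Suc t)) else if e = h 1 then ct (h 0)
     else if e = k 1 then ct (k 2) else cs e)" for e
  define ct' where "ct' e =
    (if e = l 1 then cs (l 0) else if e \<in> l ` {2..t} then ct (l (Suc t))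
     else if e \<in> r ` {1..t} then cs (r (Suc t)) else if e = h 1 then cs (h 2)
     else if e = k 1 then cs (k 0) else ct e)" for e
  define d' where "d' p =
    (if p \<in> VP then if p = along up (r 1) (l 1) then U else {#}
     else if p = HP then W else d p)" for p
  have old: "cs' e = cs e" "ct' e = ct e" if "e \<notin> C" for e
    using that t by (auto simp: C_def cs'_def ct'_def)
  have cs'_lr: "cs' (l i) = (if i \<in> {1..t} then ct (l (Suc t)) else cs (l i))"
      "cs' (r i) = (if i = 1 then ct (r 0) else if i \<in> {2..t} then cs (r (Suc t)) else cs (r i))"
      "ct' (l i) = (if i = 1 then cs (l 0) else if i \<in> {2..t} then ct (l (Suc t)) else ct (l i))"
      "ct' (r i) = (if i \<in> {1..t} then cs (r (Suc t)) else ct (r i))" if "i < 5" for i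
    using that unfolding cs'_def ct'_def by (simp_all add: ne mem nmem del: image_iff)
  have cs'_hk: "cs' (h i) = (if i = 1 then ct (h 0) else cs (h i))"
      "cs' (k i) = (if i = 1 then ct (k 2) else cs (k i))"
      "ct' (h i) = (if i = 1 then cs (h 2) else ct (h i))"
      "ct' (k i) = (if i = 1 then cs (k 0) else ct (k i))" if "i < 3" for i
    using that unfolding cs'_def ct'_def by (simp_all add: ne nmem' del: image_iff)

  have "relaxed D P d' cs' ct'"
    unfolding relaxed_def
  proof (intro conjI ballI)
    fix e assume "e \<in> edges D"
    moreover have "Suc t < 5" using t by auto
    ultimately show "cs' e \<in> Q" "ct' e \<in> Q"
      using inQ in_edges in_edges' by (simp_all add: cs'_def ct'_def)
  next
    fix v assume "v \<in> verts D"
    then consider "v \<in> structure_joints l r h k" | "v \<in> verts D' - structure_crossings ty l r h k"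
      using V(2) by blast
    then show "vertex_ok cs' ct' v"
    proof cases
      case 1
      have four: "i < 4 \<Longrightarrow> i = 0 \<or> i = 1 \<or> i = 2 \<or> i = 3" for i :: nat
        by auto
      have "ct' (l (Suc i)) = cs' (l i)" "ct' (r i) = cs' (r (Suc i))" if "i < 4" for i
        using four[OF that] t sh by (auto simp: cs'_lr shift_def numeral_eq_Suc)
      moreover have "ct' (h i) = cs' (h (Suc i))" "ct' (k (Suc i)) = cs' (k i)" if "i < 2" for i
        using less_2_cases[OF that] sh by (auto simp: cs'_hk shift_def numeral_2_eq_2)
      ultimately show ?thesis
        using 1 by (auto simp: structure_joints_def)
    next
      case 2
      then have "vertex_ok cs ct v"
        using rel by (simp add: relaxed_def)
      then show ?thesis
        using verts_C[OF 2] old by (subst vertex_ok_cong[of v cs' cs ct' ct]) auto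
    qed
  next
    fix e assume e: "e \<in> edges D - Field P"
    then have "e \<notin> Field P'" "e \<notin> C"
      using C_Field by (auto simp: P'_eq Field_def)
    then show "ct' e = cs' e"
      using e rel edges old by (simp add: relaxed_def)
  next
    fix p assume p: "p \<in> P"
    have one: "Suc 0 < 5" "Suc 0 \<le> t" "2 \<le> t" using t by auto
    consider "p \<in> P'" | "p = along up (r 1) (l 1)" | i where "p = along up (r i) (l i)" "i \<in> {2..t}"
      | "p = HP"
    proof -
      have "{1..t} = insert 1 {2..t}"
        using t by auto
      then have VP_eq: "VP = insert (along up (r 1) (l 1)) ((\<lambda>i. along up (r i) (l i)) ` {2..t})"
        by (simp add: VP_def)
      consider "p \<in> P'" | "p \<in> VP" | "p = HP"
        using p by (auto simp: P'_eq)
      then show thesis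
      proof cases
        case 2
        then show thesis
          unfolding VP_eq by (elim insertE imageE) (use that(2,3) in blast)+
      qed (use that(1,4) in blast)+
    qed
    then show "case p of (a, b) \<Rightarrow> ct' a = act (d' (a, b)) (cs' a) \<and> cs' b = act (d' (a, b)) (ct' b)"
    proof cases
      case 1
      obtain a b where ab: "p = (a, b)" by force
      then have "d' (a, b) = d (a, b)"
        using 1 by (auto simp: d'_def P'_eq)
      then show ?thesis
        using ab 1 pair[of a b] P'_C[of a b] old by simp
    next
      case 2
      then have "d' p = U"
        using t by (auto simp: d'_def VP_def)
      moreover have "ct' (r 1) = act u (cs' (r 1))" "cs' (l 1) = act u (ct' (l 1))"
        using sh one by (auto simp: cs'_lr shift_def)
      ultimately show ?thesis
        using 2 by (auto simp: along_def U_def act_swap)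
    next
      case (3 i)
      then have "i < 5" "i \<noteq> 1" "i \<in> {1..t}"
        using t by auto
      then have "d' p = {#}"
        using 3 by (auto simp: d'_def VP_def along_def ne split: if_splits)
      moreover have "ct' (r i) = cs' (r i)" "cs' (l i) = ct' (l i)"
        using \<open>i < 5\<close> 3 by (auto simp: cs'_lr)
      ultimately show ?thesis
        using 3 by (auto simp: along_def)
    next
      case 4
      have "HP \<notin> VP"
        using sub unfolding HP_def VP_def along_def by (auto simp: ne subset_iff)
      then have "d' p = W"
        using 4 by (simp add: d'_def)
      moreover have "ct' (h 1) = act w (cs' (h 1))" "cs' (k 1) = act w (ct' (k 1))"
        using sh by (auto simp: cs'_hk shift_def)
      ultimately show ?thesis
        using 4 by (auto simp: HP_def along_def W_def act_swap)
    qed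
  qed
  then have concl: "ct' (snk1 D) = act (\<Sum>p\<in>P. d' p) (cs' (src1 D))"
      "cs' (src2 D) = act (\<Sum>p\<in>P. d' p) (ct' (snk2 D))"
      "\<And>a b. (a, b) \<in> P \<Longrightarrow> disp (cs' a, ct' b) = disp (cs' (src1 D), ct' (snk2 D))"
    using bal unfolding balanced_def by blast+

  \<comment> \<open>By the induction hypothesis both pairs have the displacement of the starting
    pair. If the path runs down or to the left, it enters the pair on the far side of the shift,
    where the displacement is the same by \<open>disp_act\<close>.\<close>
  have "(if up then disp (ct (r 0), cs (l 0)) else disp (cs (l 0), ct (r 0))) =
       (if right then disp (ct (h 0), cs (k 0)) else disp (cs (k 0), ct (h 0)))"
  proof -
    have "(if up then disp (ct (r 0), cs (l 0)) else disp (cs (l 0), ct (r 0))) =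
      disp (cs' (src1 D), ct' (snk2 D))"
      using concl(3)[of "r 1" "l 1"] concl(3)[of "l 1" "r 1"] ver[of 1] sh inQ in_edges t
      by (cases up) (auto simp: along_def cs'_lr shift_def disp_act)
    moreover have "(if right then disp (ct (h 0), cs (k 0)) else disp (cs (k 0), ct (h 0))) =
      disp (cs' (src1 D), ct' (snk2 D))"
      using concl(3)[of "h 1" "k 1"] concl(3)[of "k 1" "h 1"] hor[of 1] sh inQ in_edges'
      by (cases right) (auto simp: along_def cs'_hk shift_def disp_act)
    ultimately show ?thesis
      by simp
  qed
  then have UW: "act (U + W) z = z" for z
    using cancel[OF dir] unfolding U_def W_def by blast
  have fin: "finite P"
    using mat by (simp add: matching_def)
  have "HP \<notin> VP"
    using sub unfolding HP_def VP_def along_def by (auto simp: ne subset_iff)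
  have "(\<Sum>p\<in>VP. d' p) = (\<Sum>p\<in>VP. if p = along up (r 1) (l 1) then U else {#})"
    by (intro sum.cong) (auto simp: d'_def)
  also have "\<dots> = U"
    using t by (auto simp: VP_def)
  finally have "(\<Sum>p\<in>VP \<union> {HP}. d' p) = U + W"
    using \<open>HP \<notin> VP\<close> by (simp add: VP_def d'_def[of HP])
  moreover have "(\<Sum>p\<in>P'. d' p) = (\<Sum>p\<in>P'. d p)"
    by (intro sum.cong) (auto simp: d'_def P'_eq)
  ultimately have "(\<Sum>p\<in>P. d' p) = (\<Sum>p\<in>P'. d p) + (U + W)"
    using sum.subset_diff[of "VP \<union> {HP}" P d'] VP HP fin by (simp add: P'_eq)
  then have sum: "act (\<Sum>p\<in>P. d' p) z = act (\<Sum>p\<in>P'. d p) z" for z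
    by (simp only: act_plus[of _ "U + W"] UW)
  have "disp (cs a, ct b) = disp (cs (src1 D), ct (snk2 D))" if "(a, b) \<in> P'" for a b
    using concl(3)[of a b] that P'_C[OF that] old ends_C by (auto simp: P'_eq)
  then show "ct (snk1 D') = act (\<Sum>p\<in>P'. d p) (cs (src1 D')) \<and>
     cs (src2 D') = act (\<Sum>p\<in>P'. d p) (ct (snk2 D')) \<and>
     (\<forall>(a, b)\<in>P'. disp (cs a, ct b) = disp (cs (src1 D'), ct (snk2 D')))"
    using concl(1,2) unfolding sum ends old(1)[OF ends_C(1)] old(1)[OF ends_C(2)]
      old(2)[OF ends_C(3)] old(2)[OF ends_C(4)] by blast
qed

lemma matching_balanced_lom_construction:
  "lom_construction D P \<Longrightarrow> matching (edges D) P \<and> balanced D P"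
proof (induction rule: lom_construction.induct)
  case (trivial a b D)
  have "matching (edges D) {(a, b)}"
    using trivial by (auto simp: matching_def)
  moreover have "balanced D {(a, b)}"
    using trivial by (auto simp: balanced_def relaxed_def)
  ultimately show ?case
    by blast
next
  case (subdivide_pair D P e f e' f')
  then show ?case
    using matching_split[of "edges D" P e f e' f'] balanced_subdivide_pair[of D P e f e' f']
    by (simp add: subdivide_def)
next
  case (move D P ty up right l r h k D' P')
  then have "balanced D' P'"
    by (intro balanced_move[of D P ty up right l r h k _ D' P']) auto
  moreover have "edges D' = edges D"
    using move by (simp add: local_change_def)
  moreover have "P' \<subseteq> P"
    using move by blast
  ultimately show ?case
    using move.IH matching_subset[of "edges D" P P'] by simp
qed

end

section \<open>Edge colorings and Reidemeister moves\<close>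

context quandle
begin

text \<open>Colors are put on edges because the local moves keep the edges while they change the
  arcs.\<close>

definition edge_coloring :: "('z) diagram_scheme \<Rightarrow> (nat \<Rightarrow> 'a) \<Rightarrow> bool" where
  "edge_coloring D c \<longleftrightarrow> (\<forall>e\<in>edges D. c e \<in> Q) \<and> (\<forall>v\<in>verts D. vertex_ok c c v)"

definition coherent :: "two_strand_diagram \<Rightarrow> bool" where
  "coherent D \<longleftrightarrow> (\<forall>c. edge_coloring D c \<longrightarrow>
     c (src1 D) = c (snk1 D) \<and> c (src2 D) = c (snk2 D))"

definition colorings_transfer :: "two_strand_diagram \<Rightarrow> two_strand_diagram \<Rightarrow> bool" where
  "colorings_transfer D D' \<longleftrightarrow> (\<forall>c. edge_coloring D c \<longrightarrow> (\<exists>c'. edge_coloring D' c' \<and>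
     c' (src1 D') = c (src1 D) \<and> c' (snk1 D') = c (snk1 D) \<and>
     c' (src2 D') = c (src2 D) \<and> c' (snk2 D') = c (snk2 D)))"

lemma coherent_if_colorings_transfer: "colorings_transfer D D' \<Longrightarrow> coherent D' \<Longrightarrow> coherent D"
  unfolding colorings_transfer_def coherent_def by metis

lemma arc_cong:
  assumes "v \<in> verts D" "(a, b) \<in> over_passages v"
  shows "arc D a = arc D b"
proof -
  let ?R = "\<lambda>a b. \<exists>v\<in>verts D. (a, b) \<in> over_passages v"
  have "equivclp ?R a b"
    using assms by blast
  then have "equivclp ?R a = equivclp ?R b"
    using equivp_evquivclp[of ?R] by (simp add: equivp_def)
  then show ?thesis
    by (simp add: arc_def)
qed

lemma edge_coloring_of_coloring:
  assumes "coloring Q mult D f"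
  shows "edge_coloring D (\<lambda>e. f (arc D e))"
  unfolding edge_coloring_def
proof (intro conjI ballI)
  fix e assume "e \<in> edges D"
  then show "f (arc D e) \<in> Q"
    using assms by (auto simp: coloring_def arcs_def)
next
  fix v assume v: "v \<in> verts D"
  show "vertex_ok (\<lambda>e. f (arc D e)) (\<lambda>e. f (arc D e)) v"
  proof (cases v)
    case (Crossing s oi oo ui uo)
    then have "f (arc D (under_right s ui uo)) = f (arc D (under_left s ui uo)) \<triangleright> f (arc D oi)"
      using assms v by (auto simp: coloring_def)
    moreover have "arc D oi = arc D oo"
      using arc_cong[OF v] Crossing by simp
    ultimately show ?thesis
      using Crossing by (cases s) (simp_all add: under_right_def under_left_def)
  next
    case (Joint e e')
    then show ?thesis
      using arc_cong[OF v] by simp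
  qed
qed

lemma ends_eq_if_coherent:
  assumes "coherent D" "starting_pair D = (a0, b0)" "ending_pair D = (ae, be)" "coloring Q mult D f"
  shows "f a0 = f ae \<and> f b0 = f be"
  using assms edge_coloring_of_coloring[OF assms(4)]
  by (auto simp: coherent_def starting_pair_def ending_pair_def)

end

section \<open>Transfer of colorings along isotopies and Reidemeister moves\<close>

lemma planar_passages:
  assumes "planar D" "v \<in> verts D"
  shows "Domain (passages v) \<subseteq> edges D" "Range (passages v) \<subseteq> edges D"
proof -
  have "Domain (pass D) \<subseteq> edges D" "Range (pass D) \<subseteq> edges D"
    using assms(1) by (auto simp: planar_def)
  then show "Domain (passages v) \<subseteq> edges D" "Range (passages v) \<subseteq> edges D"
    using assms(2) unfolding pass_def by blast+
qed

lemma planar_ends: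
  assumes "planar D"
  shows "src1 D \<in> edges D" "snk1 D \<in> edges D" "src2 D \<in> edges D" "snk2 D \<in> edges D"
  using assms by (simp_all add: planar_def)

context quandle
begin

lemma vertex_ok_map_vertex: "vertex_ok cs ct (map_vertex g v) \<longleftrightarrow> vertex_ok (cs \<circ> g) (ct \<circ> g) v"
  by (cases v) simp_all

lemma colorings_transfer_renaming:
  assumes "planar D" "renaming D D'"
  shows "colorings_transfer D D'" "colorings_transfer D' D"
proof -
  obtain g where g: "inj_on g (edges D)" "edges D' = g ` edges D" "verts D' = map_vertex g ` verts D"
    and ends: "src1 D' = g (src1 D)" "snk1 D' = g (snk1 D)" "src2 D' = g (src2 D)"
      "snk2 D' = g (snk2 D)"
    using assms(2) unfolding renaming_def by blast
  show "colorings_transfer D D'"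
    unfolding colorings_transfer_def
  proof (intro allI impI)
    fix c assume c: "edge_coloring D c"
    define c' where "c' = c \<circ> inv_into (edges D) g"
    have eq: "(c' \<circ> g) e = c e" if "e \<in> edges D" for e
      using that g(1) by (simp add: c'_def)
    have "vertex_ok (c' \<circ> g) (c' \<circ> g) v" if "v \<in> verts D" for v
      using c that planar_passages[OF assms(1) that] eq
      by (subst vertex_ok_cong[of v "c' \<circ> g" c "c' \<circ> g" c]) (auto simp: edge_coloring_def)
    moreover have "c' (g e) \<in> Q" if "e \<in> edges D" for e
      using eq[OF that] c that by (simp add: edge_coloring_def)
    ultimately have "edge_coloring D' c'"
      by (auto simp: edge_coloring_def g vertex_ok_map_vertex)
    then show "\<exists>c'. edge_coloring D' c' \<and>
       c' (src1 D') = c (src1 D) \<and> c' (snk1 D') = c (snk1 D) \<and>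
       c' (src2 D') = c (src2 D) \<and> c' (snk2 D') = c (snk2 D)"
      using eq planar_ends[OF assms(1)] by (intro exI[of _ c']) (simp add: ends)
  qed
  have "edge_coloring D (c \<circ> g)" if "edge_coloring D' c" for c
    using that by (simp add: edge_coloring_def g vertex_ok_map_vertex)
  then show "colorings_transfer D' D"
    unfolding colorings_transfer_def by (metis comp_apply ends)
qed

lemma vertex_ok_cong_edges:
  assumes "planar D" "v \<in> verts D" "\<And>e. e \<in> edges D \<Longrightarrow> c' e = c e"
  shows "vertex_ok c' c' v \<longleftrightarrow> vertex_ok c c v"
  using assms planar_passages[OF assms(1,2)] by (intro vertex_ok_cong) blast+

lemma colorings_transfer_subdivision:
  assumes "planar D" "subdivision D D'"
  shows "colorings_transfer D D'" "colorings_transfer D' D"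
proof -
  obtain e e' where e: "e \<in> edges D" "e' \<notin> edges D" and D': "D' = subdivide e e' D"
    using assms(2) unfolding subdivision_def by blast
  show "colorings_transfer D D'"
    unfolding colorings_transfer_def
  proof (intro allI impI)
    fix c assume c: "edge_coloring D c"
    define c' where "c' = c(e' := c e)"
    have eq: "c' a = c a" if "a \<in> edges D" for a
      using that e by (auto simp: c'_def)
    have upd: "c'(e := c' e') = c'"
      using e by (auto simp: c'_def)
    have "vertex_ok c' c' (replace_in e e' v)" if "v \<in> verts D" for v
      using c that vertex_ok_cong_edges[OF assms(1) that eq]
      by (simp add: vertex_ok_replace_in upd edge_coloring_def)
    moreover have "c' e = c' e'"
      using e by (auto simp: c'_def)
    moreover have "c' a \<in> Q" if "a \<in> insert e' (edges D)" for a
      using that c e by (auto simp: c'_def edge_coloring_def)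
    ultimately have "edge_coloring D' c'"
      by (auto simp: edge_coloring_def D' subdivide_def)
    then show "\<exists>c'. edge_coloring D' c' \<and>
       c' (src1 D') = c (src1 D) \<and> c' (snk1 D') = c (snk1 D) \<and>
       c' (src2 D') = c (src2 D) \<and> c' (snk2 D') = c (snk2 D)"
      using eq planar_ends[OF assms(1)] \<open>c' e = c' e'\<close>
      by (intro exI[of _ c']) (auto simp: D' subdivide_def)
  qed
  show "colorings_transfer D' D"
    unfolding colorings_transfer_def
  proof (intro allI impI)
    fix c assume c: "edge_coloring D' c"
    have ee': "c e = c e'"
      using c by (simp add: edge_coloring_def D' subdivide_def)
    then have upd: "c(e := c e') = c"
      by (metis fun_upd_triv)
    have "edge_coloring D c"
      using c by (auto simp: edge_coloring_def D' subdivide_def vertex_ok_replace_in upd)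
    then show "\<exists>c'. edge_coloring D c' \<and>
       c' (src1 D) = c (src1 D') \<and> c' (snk1 D) = c (snk1 D') \<and>
       c' (src2 D) = c (src2 D') \<and> c' (snk2 D) = c (snk2 D')"
      using ee' by (intro exI[of _ c]) (auto simp: D' subdivide_def)
  qed
qed

end

text \<open>The part of \<open>local_change\<close> that matters for colorings. It is symmetric, so
  that one lemma serves a move and its inverse.\<close>

definition replaces ::
  "vertex set \<Rightarrow> vertex set \<Rightarrow> two_strand_diagram \<Rightarrow> two_strand_diagram \<Rightarrow> bool" where
  "replaces V V' D D' \<longleftrightarrow> edges D' = edges D \<and>
     src1 D' = src1 D \<and> snk1 D' = snk1 D \<and> src2 D' = src2 D \<and> snk2 D' = snk2 D \<and>
     V \<subseteq> verts D \<and> V' \<subseteq> verts D' \<and> verts D - V = verts D' - V'"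

lemma replaces_sym: "replaces V V' D D' \<Longrightarrow> replaces V' V D' D"
  by (auto simp: replaces_def)

lemma local_change_replaces:
  assumes "local_change I V V' D D'"
  shows "replaces V V' D D'"
proof -
  have "V' \<inter> (verts D - V) = {}" "verts D' = (verts D - V) \<union> V'"
    using assms by (simp_all add: local_change_def)
  then have "V' \<subseteq> verts D'" "verts D - V = verts D' - V'"
    by blast+
  then show ?thesis
    using assms by (simp add: replaces_def local_change_def)
qed

context quandle
begin

text \<open>Every edge in \<open>I\<close> enters and leaves vertices of \<open>V\<close>. By
  well-formedness it meets no remaining vertex, and by planarity it is no end edge, so only the new
  vertices have to be checked.\<close>

lemma edge_coloring_replaces:
  assumes planar: "planar D" and rep: "replaces V V' D D'" and c: "edge_coloring D c"
    and I: "I \<subseteq> Domain (\<Union>v\<in>V. passages v)" "I \<subseteq> Range (\<Union>v\<in>V. passages v)"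
    and out: "\<And>e. e \<notin> I \<Longrightarrow> c' e = c e"
    and inQ: "\<And>e. e \<in> I \<Longrightarrow> c' e \<in> Q"
    and V': "\<And>v. v \<in> V' \<Longrightarrow> vertex_ok c' c' v"
  shows "\<exists>c'. edge_coloring D' c' \<and>
     c' (src1 D') = c (src1 D) \<and> c' (snk1 D') = c (snk1 D) \<and>
     c' (src2 D') = c (src2 D) \<and> c' (snk2 D') = c (snk2 D)"
proof -
  have V: "V \<subseteq> verts D" "verts D' \<subseteq> V' \<union> (verts D - V)"
    and edges: "edges D' = edges D" and ends: "src1 D' = src1 D" "snk1 D' = snk1 D"
      "src2 D' = src2 D" "snk2 D' = snk2 D"
    using rep unfolding replaces_def by blast+
  have ends_pass: "Domain (pass D) = edges D - {snk1 D, snk2 D}"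
      "Range (pass D) = edges D - {src1 D, src2 D}"
    using planar by (simp_all add: planar_def)
  have "I \<subseteq> Domain (pass D)" "I \<subseteq> Range (pass D)"
    using order.trans[OF I(1) Domain_mono[OF UN_mono[OF V(1)]], of passages]
      order.trans[OF I(2) Range_mono[OF UN_mono[OF V(1)]], of passages]
    by (simp_all add: pass_def)
  then have ends_I: "src1 D \<notin> I" "src2 D \<notin> I" "snk1 D \<notin> I" "snk2 D \<notin> I"
    unfolding ends_pass by blast+
  have old: "vertex_ok c' c' v" if "v \<in> verts D - V" for v
  proof -
    have "Domain (passages w) \<inter> Domain (passages v) = {}"
        "Range (passages w) \<inter> Range (passages v) = {}" if "w \<in> V" for w
      using that well_formed_disjoint[of D w v] \<open>v \<in> _\<close> V(1) planar
      by (auto simp: planar_def)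
    then have "I \<inter> Domain (passages v) = {}" "I \<inter> Range (passages v) = {}"
      using I by blast+
    then have "vertex_ok c' c' v \<longleftrightarrow> vertex_ok c c v"
      using out by (intro vertex_ok_cong) blast+
    then show ?thesis
      using c that by (simp add: edge_coloring_def)
  qed
  have "c' e \<in> Q" if "e \<in> edges D" for e
    using that c out[of e] inQ[of e] by (cases "e \<in> I") (simp_all add: edge_coloring_def)
  then have "edge_coloring D' c'"
    using old V' V(2) edges unfolding edge_coloring_def by blast
  then show ?thesis
    using out ends_I ends by metis
qed

text \<open>At a crossing of a strand with itself, idempotence and right cancellation force all
  three colors to agree, just as the two joints do.\<close>

lemma colorings_transfer_reidemeister1:
  assumes "planar D" "planar D'" "reidemeister1 D D'"
  shows "colorings_transfer D D'" "colorings_transfer D' D"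
proof -
  obtain e1 e2 e3 s v where v: "v \<in> {cross s (e1, e2) (e2, e3), cross s (e2, e3) (e1, e2)}"
    and rep: "replaces {Joint e1 e2, Joint e2 e3} {v} D D'"
    using assms(3) local_change_replaces unfolding reidemeister1_def by blast
  show "colorings_transfer D D'"
    unfolding colorings_transfer_def
  proof (intro allI impI)
    fix c assume c: "edge_coloring D c"
    have "c e1 = c e2" "c e2 = c e3"
      using c rep by (auto simp: edge_coloring_def replaces_def)
    moreover have "e1 \<in> edges D"
      using rep planar_passages(1)[OF assms(1), of "Joint e1 e2"] by (auto simp: replaces_def)
    ultimately have "vertex_ok c c v"
      using v c idem[of "c e1"] by (auto simp: cross_def edge_coloring_def)
    then show "\<exists>c'. edge_coloring D' c' \<and>
       c' (src1 D') = c (src1 D) \<and> c' (snk1 D') = c (snk1 D) \<and>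
       c' (src2 D') = c (src2 D) \<and> c' (snk2 D') = c (snk2 D)"
      by (intro edge_coloring_replaces[OF assms(1) rep c, of "{}" c]) auto
  qed
  show "colorings_transfer D' D"
    unfolding colorings_transfer_def
  proof (intro allI impI)
    fix c assume c: "edge_coloring D' c"
    have "v \<in> verts D'"
      using rep by (simp add: replaces_def)
    then have ok: "vertex_ok c c v"
      and "Domain (passages v) \<subseteq> edges D'" "Range (passages v) \<subseteq> edges D'"
      using c planar_passages[OF assms(2)] by (auto simp: edge_coloring_def)
    then have Q: "c e1 \<in> Q" "c e2 \<in> Q" "c e3 \<in> Q"
      using v c by (auto simp: cross_def edge_coloring_def)
    have "c e1 = c e2 \<and> (c e3 = c e2 \<triangleright> c e1 \<or> c e2 = c e3 \<triangleright> c e1) \<or>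
        c e2 = c e3 \<and> (c e2 = c e1 \<triangleright> c e2 \<or> c e1 = c e2 \<triangleright> c e2)"
    proof -
      have "vertex_ok c c (cross s (e1, e2) (e2, e3)) \<or> vertex_ok c c (cross s (e2, e3) (e1, e2))"
        using ok v by blast
      then show ?thesis
        unfolding cross_def fst_conv snd_conv vertex_ok.simps by metis
    qed
    then have "c e1 = c e2 \<and> c e2 = c e3"
    proof (elim disjE conjE)
      assume "c e1 = c e2" "c e3 = c e2 \<triangleright> c e1"
      then show ?thesis using Q idem[of "c e2"] by simp
    next
      assume "c e1 = c e2" "c e2 = c e3 \<triangleright> c e1"
      then show ?thesis using Q idem[of "c e2"] mult_cancel[of "c e2" "c e3" "c e2"] by simp
    next
      assume "c e2 = c e3" "c e2 = c e1 \<triangleright> c e2"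
      then show ?thesis using Q idem[of "c e2"] mult_cancel[of "c e2" "c e1" "c e2"] by simp
    next
      assume "c e2 = c e3" "c e1 = c e2 \<triangleright> c e2"
      then show ?thesis using Q idem[of "c e2"] by simp
    qed
    then show "\<exists>c'. edge_coloring D c' \<and>
       c' (src1 D) = c (src1 D') \<and> c' (snk1 D) = c (snk1 D') \<and>
       c' (src2 D) = c (src2 D') \<and> c' (snk2 D) = c (snk2 D')"
      by (intro edge_coloring_replaces[OF assms(2) replaces_sym[OF rep] c, of "{}" c]) auto
  qed
qed

text \<open>Follows the under-strand in its own direction, so that both kinds of crossings are
  treated alike: negating \<open>s\<close> inverts the map, and the four distributive laws become
  one.\<close>

definition pass_under :: "bool \<Rightarrow> 'a \<Rightarrow> 'a \<Rightarrow> 'a" where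
  "pass_under s y x = (if s then x \<triangleright> y else x \<triangleleft> y)"

lemma pass_under_closed: "x \<in> Q \<Longrightarrow> y \<in> Q \<Longrightarrow> pass_under s y x \<in> Q"
  by (simp add: pass_under_def closed rdiv_closed)

lemma pass_under_not:
  "x \<in> Q \<Longrightarrow> y \<in> Q \<Longrightarrow> pass_under (\<not> s) y (pass_under s y x) = x"
  by (simp add: pass_under_def mult_rdiv rdiv_mult)

lemma pass_under_distrib:
  assumes "x \<in> Q" "y \<in> Q" "z \<in> Q"
  shows "pass_under s z (pass_under s' y x) = pass_under s' (pass_under s z y) (pass_under s z x)"
  using assms self_distrib[of x y z] mult_distrib_rdiv[of x y z] rdiv_mult_distrib[of x y z]
    rdiv_rdiv_distrib[of x y z]
  by (simp add: pass_under_def)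

lemma vertex_ok_cross:
  assumes "c (fst p) \<in> Q" "c (fst q) \<in> Q" "c (snd q) \<in> Q"
  shows "vertex_ok c c (cross s p q) \<longleftrightarrow>
    c (fst p) = c (snd p) \<and> c (snd q) = pass_under s (c (fst p)) (c (fst q))"
proof -
  have "c (fst q) = c (snd q) \<triangleright> c (fst p) \<longleftrightarrow> c (snd q) = c (fst q) \<triangleleft> c (fst p)"
    using assms mult_eqD rdiv_mult by metis
  then show ?thesis
    by (simp add: cross_def pass_under_def)
qed

lemma edge_coloring_crossD:
  assumes "edge_coloring D c" "planar D" "cross s p q \<in> verts D"
  shows "c (fst p) \<in> Q" "c (fst q) \<in> Q" "c (snd q) \<in> Q" "c (fst p) = c (snd p)"
    "c (snd q) = pass_under s (c (fst p)) (c (fst q))"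
proof -
  have "Domain (passages (cross s p q)) \<subseteq> edges D" "Range (passages (cross s p q)) \<subseteq> edges D"
    using planar_passages[OF assms(2,3)] .
  then have "fst p \<in> edges D" "fst q \<in> edges D" "snd q \<in> edges D"
    by (cases p; cases q; simp add: cross_def)+
  then show inQ: "c (fst p) \<in> Q" "c (fst q) \<in> Q" "c (snd q) \<in> Q"
    using assms(1) by (auto simp: edge_coloring_def)
  have "vertex_ok c c (cross s p q)"
    using assms(1,3) by (auto simp: edge_coloring_def)
  then show "c (fst p) = c (snd p)" "c (snd q) = pass_under s (c (fst p)) (c (fst q))"
    using vertex_ok_cross inQ by blast+
qed

lemma colorings_transfer_reidemeister2:
  assumes "planar D" "planar D'" "reidemeister2 D D'"
  shows "colorings_transfer D D'" "colorings_transfer D' D"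
proof -
  obtain e1 e2 e3 f1 f2 f3 s C I where dist: "distinct [e1, e2, e3, f1, f2, f3]"
    and C: "C \<in> {{cross s (e1, e2) (f1, f2), cross (\<not> s) (e2, e3) (f2, f3)},
        {cross s (e1, e2) (f2, f3), cross (\<not> s) (e2, e3) (f1, f2)}}"
    and loc: "local_change I {Joint e1 e2, Joint e2 e3, Joint f1 f2, Joint f2 f3} C D D'"
    using assms(3) unfolding reidemeister2_def by blast
  \<comment> \<open>The sign is renamed so that \<open>s'\<close> belongs to the crossing that the
    under-strand meets first, whether the strands run in the same or in opposite directions.\<close>
  obtain s' where C: "C = {cross s' (e1, e2) (f1, f2), cross (\<not> s') (e2, e3) (f2, f3)} \<or>
      C = {cross (\<not> s') (e1, e2) (f2, f3), cross s' (e2, e3) (f1, f2)}"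
  proof -
    consider "C = {cross s (e1, e2) (f1, f2), cross (\<not> s) (e2, e3) (f2, f3)}"
      | "C = {cross s (e1, e2) (f2, f3), cross (\<not> s) (e2, e3) (f1, f2)}"
      using C by blast
    then show thesis
      using that[of s] that[of "\<not> s"] by cases simp_all
  qed
  note rep = local_change_replaces[OF loc]
  show "colorings_transfer D D'"
    unfolding colorings_transfer_def
  proof (intro allI impI)
    fix c assume c: "edge_coloring D c"
    have V: "Joint e1 e2 \<in> verts D" "Joint e2 e3 \<in> verts D" "Joint f1 f2 \<in> verts D"
        "Joint f2 f3 \<in> verts D"
      using rep by (auto simp: replaces_def)
    have "vertex_ok c c v" if "v \<in> verts D" for v
      using c that by (simp add: edge_coloring_def)
    from V[THEN this] have eq: "c e1 = c e2" "c e3 = c e2" "c f1 = c f2" "c f3 = c f2"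
      by simp_all
    have "e2 \<in> edges D" "f2 \<in> edges D"
      using planar_passages(2)[OF assms(1) V(1)] planar_passages(2)[OF assms(1) V(3)] by auto
    then have Q: "c e2 \<in> Q" "c f2 \<in> Q"
      using c by (auto simp: edge_coloring_def)
    define c' where "c' = c(f2 := pass_under s' (c e2) (c f2))"
    have c': "c' e1 = c e2" "c' e2 = c e2" "c' e3 = c e2" "c' f1 = c f2" "c' f3 = c f2"
        "c' f2 = pass_under s' (c e2) (c f2)"
      using dist by (auto simp: c'_def eq)
    have "vertex_ok c' c' v" if "v \<in> C" for v
    proof -
      have "v \<in> {cross s' (e1, e2) (f1, f2), cross (\<not> s') (e2, e3) (f2, f3),
          cross (\<not> s') (e1, e2) (f2, f3), cross s' (e2, e3) (f1, f2)}"
        using that C by blast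
      then show ?thesis
        using Q pass_under_not[OF Q(2,1), of s']
        by (elim insertE emptyE) (simp_all add: vertex_ok_cross c' pass_under_closed)
    qed
    then show "\<exists>c'. edge_coloring D' c' \<and>
       c' (src1 D') = c (src1 D) \<and> c' (snk1 D') = c (snk1 D) \<and>
       c' (src2 D') = c (src2 D) \<and> c' (snk2 D') = c (snk2 D)"
      using Q by (intro edge_coloring_replaces[OF assms(1) rep c, of "{f2}" c'])
        (auto simp: c'_def pass_under_closed)
  qed
  show "colorings_transfer D' D"
    unfolding colorings_transfer_def
  proof (intro allI impI)
    fix c assume c: "edge_coloring D' c"
    have "C \<subseteq> verts D'"
      using rep by (simp add: replaces_def)
    then have "cross s' (e1, e2) (f1, f2) \<in> verts D' \<and> cross (\<not> s') (e2, e3) (f2, f3) \<in> verts D' \<or>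
        cross (\<not> s') (e1, e2) (f2, f3) \<in> verts D' \<and> cross s' (e2, e3) (f1, f2) \<in> verts D'"
      using C by auto
    then have "c e1 = c e2 \<and> c e2 = c e3 \<and> c e2 \<in> Q \<and> c f1 \<in> Q \<and>
        c f2 = pass_under s' (c e2) (c f1) \<and> c f3 = pass_under (\<not> s') (c e2) (c f2)"
    proof (elim disjE conjE)
      assume "cross s' (e1, e2) (f1, f2) \<in> verts D'" "cross (\<not> s') (e2, e3) (f2, f3) \<in> verts D'"
      from this(1,2)[THEN edge_coloring_crossD(4)[OF c assms(2)]]
        this(1,2)[THEN edge_coloring_crossD(5)[OF c assms(2)]]
        this(1,2)[THEN edge_coloring_crossD(1)[OF c assms(2)]]
        this(1,2)[THEN edge_coloring_crossD(2)[OF c assms(2)]]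
        this(1,2)[THEN edge_coloring_crossD(3)[OF c assms(2)]]
      show ?thesis
        by simp
    next
      assume "cross (\<not> s') (e1, e2) (f2, f3) \<in> verts D'" "cross s' (e2, e3) (f1, f2) \<in> verts D'"
      from this(1,2)[THEN edge_coloring_crossD(4)[OF c assms(2)]]
        this(1,2)[THEN edge_coloring_crossD(5)[OF c assms(2)]]
        this(1,2)[THEN edge_coloring_crossD(1)[OF c assms(2)]]
        this(1,2)[THEN edge_coloring_crossD(2)[OF c assms(2)]]
        this(1,2)[THEN edge_coloring_crossD(3)[OF c assms(2)]]
      show ?thesis
        by simp
    qed
    then have eq: "c e1 = c e2" "c e2 = c e3" "c f3 = c f1" "c f1 \<in> Q"
      using pass_under_not by metis+
    have "f2 \<in> Domain (\<Union>v\<in>C. passages v)" "f2 \<in> Range (\<Union>v\<in>C. passages v)"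
      using C by (auto simp: cross_def)
    then show "\<exists>c'. edge_coloring D c' \<and>
       c' (src1 D) = c (src1 D') \<and> c' (snk1 D) = c (snk1 D') \<and>
       c' (src2 D) = c (src2 D') \<and> c' (snk2 D) = c (snk2 D')"
      using dist eq
      by (intro edge_coloring_replaces[OF assms(2) replaces_sym[OF rep] c,
            of "{f2}" "c(f2 := c f1)"]) auto
  qed
qed

end

lemma distinct_triples:
  assumes "distinct (map t [0..<3] @ map m [0..<3] @ map b [0..<3])"
  shows "distinct [t 0, t 1, t 2, m 0, m 1, m 2, b 0, b 1, b (2::nat)]"
proof -
  have "[0..<3] = [0, 1, 2::nat]"
    by (simp add: upt_rec)
  then show ?thesis
    using assms by simp
qed

text \<open>At each of the two crossings on the top strand, the bounded triangle occupies one corner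
  next to \<open>t 1\<close>, on the same side of it; this fixes which end of \<open>m 1\<close> and \<open>b 1\<close> lies there.\<close>

lemma triple_signs:
  assumes planar: "planar D" and V: "triple t m b s1 s2 s3 p q r \<subseteq> verts D"
    and dist: "distinct (map t [0..<3] @ map m [0..<3] @ map b [0..<3])"
    and face: "bound_face D {t 1, m 1, b 1}"
  shows "s1 = s2 \<longleftrightarrow> q = r"
proof -
  have X1: "cross s1 (at p t) (at q m) \<in> verts D" and X2: "cross s2 (at (\<not> p) t) (at r b) \<in> verts D"
    using V by (simp_all add: triple_def)
  have corners: "corners_agree D (cross s1 (at p t) (at q m))"
      "corners_agree D (cross s2 (at (\<not> p) t) (at r b))"
    using planar X1 X2 by (simp_all add: planar_def well_formed_def)
  note d = distinct_triples[OF dist, simplified]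
  \<comment> \<open>\<open>\<beta>\<close> is the triangle; the outer pieces of \<open>m\<close> and
    \<open>b\<close> do not meet it, which excludes the corners next to them.\<close>
  obtain \<beta> where \<beta>: "\<beta> \<in> sides D {t 1}" "\<beta> \<notin> sides D (edges D - {t 1, m 1, b 1})"
    using face unfolding bound_face_def by blast
  have "m 0 \<in> edges D \<or> q = False" "m 2 \<in> edges D \<or> q = True"
    "b 0 \<in> edges D \<or> r = False" "b 2 \<in> edges D \<or> r = True"
    using planar_passages[OF planar X1] planar_passages[OF planar X2]
    by (auto simp: cross_def at_def split: if_splits)
  then have "q \<longrightarrow> \<beta> \<noteq> lft D (m 0) \<and> \<beta> \<noteq> rgt D (m 0)" "\<not> q \<longrightarrow> \<beta> \<noteq> lft D (m 2) \<and> \<beta> \<noteq> rgt D (m 2)"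
    "r \<longrightarrow> \<beta> \<noteq> lft D (b 0) \<and> \<beta> \<noteq> rgt D (b 0)" "\<not> r \<longrightarrow> \<beta> \<noteq> lft D (b 2) \<and> \<beta> \<noteq> rgt D (b 2)"
    using \<beta>(2) d by (auto simp: sides_def)
  moreover have "\<beta> = lft D (t 1) \<or> \<beta> = rgt D (t 1)"
    using \<beta>(1) by (auto simp: sides_def)
  ultimately show ?thesis
    using corners
    by - (cases p; cases q; cases r; cases s1; cases s2; auto simp: cross_def at_def)
qed

context quandle
begin

text \<open>The identity behind the move is \<open>pass_under_distrib\<close>: the bottom strand may
  go under \<open>t\<close> and \<open>m\<close> in either order if the color of \<open>m\<close> is
  changed accordingly. By \<open>signs\<close> the bottom strand goes under \<open>t\<close> in the
  direction that turns the color of \<open>m\<close> used in one order into the one used in the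
  other.\<close>

lemma colorings_transfer_triple:
  assumes planar: "planar D"
    and rep: "replaces (triple t m b s1 s2 s3 p q r) (triple t m b s1 s2 s3 (\<not> p) (\<not> q) (\<not> r)) D D'"
    and dist: "distinct (map t [0..<3] @ map m [0..<3] @ map b [0..<3])"
    and signs: "s1 = s2 \<longleftrightarrow> q = r"
  shows "colorings_transfer D D'"
  unfolding colorings_transfer_def
proof (intro allI impI)
  fix c assume c: "edge_coloring D c"
  let ?V = "triple t m b s1 s2 s3 p q r"
  have "?V \<subseteq> verts D"
    using rep by (simp add: replaces_def)
  then have X: "cross s1 (at p t) (at q m) \<in> verts D" "cross s2 (at (\<not> p) t) (at r b) \<in> verts D"
      "cross s3 (at (\<not> q) m) (at (\<not> r) b) \<in> verts D"
    by (simp_all add: triple_def)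
  note E = edge_coloring_crossD[OF c planar X(1)] edge_coloring_crossD[OF c planar X(2)]
    edge_coloring_crossD[OF c planar X(3)]
  note d = distinct_triples[OF dist, simplified]
  \<comment> \<open>After the move \<open>m 1\<close> is separated from one outer piece of
    \<open>m\<close> only by the crossing over \<open>b\<close>, so it has the color of that piece,
    which is \<open>m 0\<close> exactly if \<open>q\<close> holds.\<close>
  define m1 where "m1 = (if q then c (m 0) else c (m 2))"
  define b1 where "b1 = (if r then pass_under s3 m1 (c (b 0)) else pass_under s2 (c (t 0)) (c (b 0)))"
  define c' where "c' = c(m 1 := m1, b 1 := b1)"
  have Q: "c (t 0) \<in> Q" "c (t 1) = c (t 0)" "c (t 2) = c (t 0)" "c (m 0) \<in> Q" "c (m 2) \<in> Q"
      "c (b 0) \<in> Q" "c (b 2) \<in> Q"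
    using E by (auto simp: at_def split: if_splits)
  have m2: "c (m 2) = pass_under s1 (c (t 0)) (c (m 0))"
    using E Q by (auto simp: at_def split: if_splits)
  have m0: "c (m 0) = pass_under (\<not> s1) (c (t 0)) (c (m 2))"
    using Q pass_under_not by (simp add: m2)
  have b2: "c (b 2) = (if r then pass_under s3 (if q then c (m 2) else c (m 0))
        (pass_under s2 (c (t 0)) (c (b 0)))
      else pass_under s2 (c (t 0)) (pass_under s3 (if q then c (m 2) else c (m 0)) (c (b 0))))"
    using E Q by (auto simp: at_def split: if_splits)
  have m1Q: "m1 \<in> Q" and b1Q: "b1 \<in> Q"
    using Q by (simp_all add: m1_def b1_def pass_under_closed)
  have c': "c' (t 0) = c (t 0)" "c' (t 1) = c (t 0)" "c' (t 2) = c (t 0)" "c' (m 0) = c (m 0)"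
      "c' (m 1) = m1" "c' (m 2) = c (m 2)" "c' (b 0) = c (b 0)" "c' (b 1) = b1" "c' (b 2) = c (b 2)"
    using d Q by (auto simp: c'_def)
  have b2': "c (b 2) = (if r then pass_under s2 (c (t 0)) b1 else pass_under s3 m1 b1)"
  proof -
    have "s2 = (if q = r then s1 else \<not> s1)"
      using signs by auto
    then have M: "pass_under s2 (c (t 0)) (if q = r then c (m 0) else c (m 2)) =
        (if q = r then c (m 2) else c (m 0))"
      using m2[symmetric] m0[symmetric] by simp
    have D: "pass_under s2 (c (t 0)) (pass_under s3 x (c (b 0))) =
        pass_under s3 (pass_under s2 (c (t 0)) x) (pass_under s2 (c (t 0)) (c (b 0)))"
      if "x \<in> Q" for x
      using that Q by (intro pass_under_distrib)
    show ?thesis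
      using M D[OF Q(4)] D[OF Q(5)] unfolding b2 b1_def m1_def
      by (cases q; cases r) simp_all
  qed
  have "vertex_ok c' c' v" if "v \<in> triple t m b s1 s2 s3 (\<not> p) (\<not> q) (\<not> r)" for v
  proof -
    have "vertex_ok c' c' (cross s1 (at (\<not> p) t) (at (\<not> q) m))"
      using Q m1Q m2 by (subst vertex_ok_cross) (auto simp: at_def c'[simplified] m1_def)
    moreover have "vertex_ok c' c' (cross s2 (at p t) (at (\<not> r) b))"
      using Q b1Q b2' by (subst vertex_ok_cross) (auto simp: at_def c'[simplified] b1_def)
    moreover have "vertex_ok c' c' (cross s3 (at q m) (at r b))"
      using Q m1Q b1Q b2' by (subst vertex_ok_cross) (auto simp: at_def c'[simplified] b1_def m1_def)
    ultimately show ?thesis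
      using that by (auto simp: triple_def)
  qed
  moreover have "{m 1, b 1} \<subseteq> Domain (\<Union>v\<in>?V. passages v)" "{m 1, b 1} \<subseteq> Range (\<Union>v\<in>?V. passages v)"
    by (auto simp: triple_def cross_def at_def)
  ultimately show "\<exists>c'. edge_coloring D' c' \<and>
     c' (src1 D') = c (src1 D) \<and> c' (snk1 D') = c (snk1 D) \<and>
     c' (src2 D') = c (src2 D) \<and> c' (snk2 D') = c (snk2 D)"
    using m1Q b1Q d
    by (intro edge_coloring_replaces[OF planar rep c, of "{m 1, b 1}" c']) (auto simp: c'_def)
qed

lemma colorings_transfer_reidemeister3:
  assumes "planar D" "planar D'" "reidemeister3 D D'"
  shows "colorings_transfer D D'" "colorings_transfer D' D"
proof -
  obtain t m b s1 s2 s3 p q r where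
    dist: "distinct (map t [0..<3] @ map m [0..<3] @ map b [0..<3])"
    and loc: "local_change {t 1, m 1, b 1}
       (triple t m b s1 s2 s3 p q r) (triple t m b s1 s2 s3 (\<not> p) (\<not> q) (\<not> r)) D D'"
    and face: "bound_face D {t 1, m 1, b 1}"
    using assms(3) unfolding reidemeister3_def by blast
  note rep = local_change_replaces[OF loc]
  have signs: "s1 = s2 \<longleftrightarrow> q = r"
    using rep triple_signs[OF assms(1) _ dist face, of s1 s2 s3 p q r] by (simp add: replaces_def)
  show "colorings_transfer D D'"
    using assms(1) rep dist signs by (rule colorings_transfer_triple)
  show "colorings_transfer D' D"
    using colorings_transfer_triple[OF assms(2) _ dist, of s1 s2 s3 "\<not> p" "\<not> q" "\<not> r" D]
      replaces_sym[OF rep] signs by simp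
qed

lemma coherent_reidemeister_equivalent:
  assumes "reidemeister_equivalent D D'"
  shows "coherent D \<longleftrightarrow> coherent D'"
  using assms unfolding reidemeister_equivalent_def
proof (induction rule: equivclp_induct)
  case (step D1 D2)
  have "coherent D \<longleftrightarrow> coherent D'" if "planar D" "planar D'"
    "renaming D D' \<or> subdivision D D' \<or> reidemeister1 D D' \<or> reidemeister2 D D' \<or> reidemeister3 D D'"
    for D D'
    using that colorings_transfer_renaming[of D D'] colorings_transfer_subdivision[of D D']
      colorings_transfer_reidemeister1[of D D'] colorings_transfer_reidemeister2[of D D']
      colorings_transfer_reidemeister3[of D D'] coherent_if_colorings_transfer by blast
  then show ?case
    using step by blast
qed simp

end

lemma isotopic_imp_reidemeister_equivalent: "isotopic D D' \<Longrightarrow> reidemeister_equivalent D D'"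
  unfolding isotopic_def
proof (induction rule: equivclp_induct)
  case (step D1 D2)
  then show ?case
    unfolding reidemeister_equivalent_def by (elim equivclp_into_equivclp) blast
qed (simp add: reidemeister_equivalent_def)

context medial_quandle
begin

lemma coherent_if_balanced:
  assumes "balanced D P"
  shows "coherent D"
  unfolding coherent_def
proof (intro allI impI)
  fix c assume "edge_coloring D c"
  then have "relaxed D P (\<lambda>_. {#}) c c"
    by (auto simp: relaxed_def edge_coloring_def)
  then show "c (src1 D) = c (snk1 D) \<and> c (src2 D) = c (snk2 D)"
    using assms unfolding balanced_def by fastforce
qed

lemma coherent_lom_diagram: "lom_diagram L \<Longrightarrow> coherent L"
  unfolding lom_diagram_def
  using matching_balanced_lom_construction coherent_if_balanced coherent_reidemeister_equivalent
    isotopic_imp_reidemeister_equivalent by metis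

end

theorem theorem5p1:
  fixes Q :: "'a set" and mult :: "'a \<Rightarrow> 'a \<Rightarrow> 'a"
  assumes "medial_quandle Q mult"
  shows "(\<forall>L f a0 b0 ae be.
            lom_diagram L \<longrightarrow> starting_pair L = (a0, b0) \<longrightarrow> ending_pair L = (ae, be) \<longrightarrow>
            coloring Q mult L f \<longrightarrow> f a0 = f ae \<and> f b0 = f be) \<and>
         (\<forall>D L f a0 b0 ae be.
            open_strand_diagram D \<longrightarrow> lom_diagram L \<longrightarrow> reidemeister_equivalent D L \<longrightarrow>
            starting_pair D = (a0, b0) \<longrightarrow> ending_pair D = (ae, be) \<longrightarrow>
            coloring Q mult D f \<longrightarrow> f a0 = f ae \<and> f b0 = f be)"
proof -
  interpret medial_quandle Q mult
    by fact
  show ?thesis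
    using ends_eq_if_coherent coherent_lom_diagram coherent_reidemeister_equivalent by blast
qed

end
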